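(* Let $X_1,X_2,\dots$ be i.i.d. nonnegative random variables such that $\frac1n\sum_{j=1}^nX_j\to c$ almost surely as $n\to\infty$ for some $c\in(0,\infty)$, and let $\Sigma_k=X_1+\dots+X_k$ ($\Sigma_0=0$). Let $r>0$, $\alpha\in\mathbb R\setminus\{0\}$, and for each $n\in\mathbb N$ let $N_{r,\alpha,1/n^{\alpha}}$ have the generalized negative binomial distribution with parameters $r,\alpha,\mu=n^{-\alpha}$ and be independent of $X_1,X_2,\dots$. Then $$\lim_{n\to\infty}\sup_{x\ge0}\Big|\mathsf P\big(\Sigma_{N_{r,\alpha,1/n^{\alpha}}}<nx\big)-\int_0^x g^*(z;r,\alpha,c^{-\alpha})\,dz\Big|=0.$$ If, moreover, $r\in(0,1)$ and $\alpha\in(0,1)$, then the limit GG distribution is mixed exponential: $$G^*_{r,\alpha,c^{-\alpha}}\stackrel{d}{=}\frac{cW_1}{S_{\alpha,1}Z_{r,1}^{1/\alpha}}$$ with independent factors.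
   Context: The generalized gamma density is $g^*(x;r,\alpha,\lambda)=\frac{|\alpha|\lambda^r}{\Gamma(r)}x^{\alpha r-1}e^{-\lambda x^{\alpha}}$, $x\ge0$ ($r>0$, $\lambda>0$, $\alpha\ne0$); $G^*_{r,\alpha,\lambda}$ denotes a random variable with this density. $N_{r,\alpha,\mu}$ has the generalized negative binomial distribution: $\mathsf P(N_{r,\alpha,\mu}=k)=\frac1{k!}\int_0^\infty e^{-z}z^kg^*(z;r,\alpha,\mu)\,dz$, $k\ge0$. $W_1$ is standard exponential. $G_{s,1}$ is gamma with density $\frac1{\Gamma(s)}x^{s-1}e^{-x}$. For $0<\alpha<1$, $S_{\alpha,1}$ has characteristic function $\exp\{-|t|^{\alpha}\exp(-\tfrac12 i\pi\alpha\,\mathrm{sign}\,t)\}$. $Z_{r,1}=(G_{r,1}+G_{1-r,1})/G_{r,1}$ with independent gamma factors. A distribution is mixed exponential if it is the law of $W_1/V$ with $V>0$ independent of $W_1$. *)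

theory Defs
  imports "HOL-Probability.Probability"
begin

definition gg_density :: "real \<Rightarrow> real \<Rightarrow> real \<Rightarrow> real \<Rightarrow> real" where
  "gg_density r \<alpha> l x =
     (if x > 0 then \<bar>\<alpha>\<bar> * l powr r / Gamma r * x powr (\<alpha> * r - 1) * exp (- l * x powr \<alpha>)
      else 0)"

definition gamma_density :: "real \<Rightarrow> real \<Rightarrow> real" where
  "gamma_density s x = (if x > 0 then x powr (s - 1) * exp (- x) / Gamma s else 0)"

definition gnb_pmf :: "real \<Rightarrow> real \<Rightarrow> real \<Rightarrow> nat \<Rightarrow> real" where
  "gnb_pmf r \<alpha> \<mu> k = (1 / fact k) * (\<integral>z. exp (- z) * z ^ k * gg_density r \<alpha> \<mu> z \<partial>lborel)"

end

theory Submission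
  imports Defs "HOL-Complex_Analysis.Complex_Analysis" "HOL-Real_Asymp.Real_Asymp"
begin

text \<open>
  Conditionally on the mixing variable, \<open>N n\<close> is Poisson, and the substitution \<open>z = n * y\<close> shows that
  its mean is \<open>n * y\<close> with \<open>y\<close> drawn from the density \<open>gg_density r \<alpha> 1\<close>, whatever \<open>n\<close> is. By Chernoff's
  bound, monotonicity of the partial sums and the law of large numbers, the random sum divided by \<open>n\<close>
  then concentrates at \<open>c * y\<close>; dominated convergence gives convergence of the distribution functions,
  and Polya's argument makes it uniform since the limit is continuous.

  For the mixture representation, the characteristic function of the stable law extends to a bounded
  holomorphic function on the upper half plane. Integrating it against \<open>1 / (t\<^sup>2 + v\<^sup>2)\<close> and against a
  kernel with poles only in the lower half plane shows that \<open>S\<close> is almost surely positive with Laplace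
  transform \<open>exp (- (s powr \<alpha>))\<close>. Integrating out \<open>W\<close>, \<open>S\<close> and \<open>G2\<close> in turn leaves a gamma tail, which
  is the tail of the generalized gamma law.
\<close>

section \<open>Generalized gamma densities and Poisson mixtures\<close>

text \<open>The law of \<open>N n\<close> is known only through its probabilities, and no mixing
  variable lives on \<open>M\<close>. The Poisson mixture is therefore an identity between
  integrals: the probability of \<open>Sigma_N < n * x\<close> is the integral of
  \<open>gg_density r \<alpha> 1 y\<close> times a Poisson average over the number of summands, and
  only that average depends on \<open>n\<close>. Nonnegativity of the \<open>X j\<close> makes the
  averaged probabilities decrease in the number of summands, so their value at a single index
  controls a whole side of it.

  In the second half, nothing but a characteristic function on the real line is known about
  \<open>S\<close>; positivity and the Laplace transform have to be extracted from it. They are what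
  the computation consumes: the exponential tail of \<open>W\<close> is a Laplace transform in
  \<open>S\<close>, the exponents \<open>\<alpha>\<close> and \<open>1 / \<alpha>\<close> then
  cancel, and what remains is a Laplace transform in \<open>G2\<close>.\<close>

lemma gamma_density_nonneg [simp]: "s > 0 \<Longrightarrow> 0 \<le> gamma_density s x"
  by (simp add: gamma_density_def)

lemma borel_measurable_gamma_density [measurable]: "gamma_density s \<in> borel_measurable borel"
  unfolding gamma_density_def[abs_def] by measurable

lemma gg_density_nonneg [simp]: "r > 0 \<Longrightarrow> 0 \<le> gg_density r \<alpha> l x"
  by (simp add: gg_density_def)

lemma borel_measurable_gg_density [measurable]: "gg_density r \<alpha> l \<in> borel_measurable borel"
  unfolding gg_density_def[abs_def] by measurable

lemma nn_integral_gamma_density: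
  assumes "s > 0"
  shows "(\<integral>\<^sup>+x. ennreal (gamma_density s x) \<partial>lborel) = 1"
proof -
  have "(\<integral>\<^sup>+x. ennreal (gamma_density s x) \<partial>lborel) =
    (\<integral>\<^sup>+x. ennreal (indicator {0..} x * x powr (s - 1) / exp x) * ennreal (1 / Gamma s) \<partial>lborel)"
    using assms by (intro nn_integral_cong)
     (auto simp: gamma_density_def indicator_def exp_minus divide_simps simp flip: ennreal_mult')
  also have "\<dots> = ennreal (Gamma s) * ennreal (1 / Gamma s)"
    by (subst nn_integral_multc) (auto simp: Gamma_conv_nn_integral_real[OF assms])
  also have "\<dots> = 1"
    using Gamma_real_pos[OF assms] by (simp flip: ennreal_mult')
  finally show ?thesis .
qed

lemma integrable_gamma_density: "s > 0 \<Longrightarrow> integrable lborel (gamma_density s)"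
  by (intro integrableI_nonneg) (auto simp: nn_integral_gamma_density)

text \<open>A change of variables: a power of a generalized gamma variable is gamma distributed.
  Testing on an arbitrary Borel set \<open>T\<close> yields both the normalisation (the whole line)
  and the tails needed for the mixed exponential law (a half line). The absolute value of the
  derivative covers negative \<open>\<alpha>\<close>, where the map decreases.\<close>

lemma nn_integral_gg_density_powr:
  assumes r: "r > 0" and \<alpha>: "\<alpha> \<noteq> 0" and l: "l > 0" and T: "T \<in> sets borel"
  shows "(\<integral>\<^sup>+x. ennreal (gg_density r \<alpha> l x) * indicator T (l * x powr \<alpha>) \<partial>lborel) =
         (\<integral>\<^sup>+u. ennreal (gamma_density r u) * indicator T u \<partial>lborel)"
proof -
  define S where "S = {x. 0 < x \<and> l * x powr \<alpha> \<in> T}"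
  define g where "g = (\<lambda>x. l * x powr \<alpha>)"
  define g' where "g' = (\<lambda>x. l * (\<alpha> * x powr (\<alpha> - 1)))"
  note T [measurable]
  have S: "S \<in> sets borel" unfolding S_def by measurable
  have img: "g ` S = T \<inter> {0<..}"
  proof (intro set_eqI iffI)
    fix u assume u: "u \<in> T \<inter> {0<..}"
    then have "u = g ((u / l) powr (1 / \<alpha>))"
      using l \<alpha> by (simp add: g_def powr_powr)
    moreover have "(u / l) powr (1 / \<alpha>) \<in> S"
      using u l \<alpha> by (simp add: S_def powr_powr)
    ultimately show "u \<in> g ` S" by blast
  qed (use l in \<open>auto simp: S_def g_def\<close>)
  have inj: "inj_on g S"
  proof (rule inj_onI)
    fix x y assume "x \<in> S" "y \<in> S" "g x = g y"
    then have "x powr \<alpha> = y powr \<alpha>" "x > 0" "y > 0" using l by (auto simp: S_def g_def)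
    then have "(x powr \<alpha>) powr (1 / \<alpha>) = (y powr \<alpha>) powr (1 / \<alpha>)" by simp
    then show "x = y" using \<open>x > 0\<close> \<open>y > 0\<close> \<alpha> by (simp add: powr_powr)
  qed
  have der: "(g has_field_derivative g' x) (at x within S)" if "x \<in> S" for x
    unfolding g_def g'_def using that
    by (auto simp: S_def intro!: has_field_derivative_at_within[OF DERIV_cmult[OF has_real_derivative_powr]])
  have eq: "\<bar>g' x\<bar> * gamma_density r (g x) = gg_density r \<alpha> l x" if "x \<in> S" for x
  proof -
    have x: "x > 0" using that by (simp add: S_def)
    have "\<bar>g' x\<bar> * gamma_density r (g x) =
       \<bar>\<alpha>\<bar> / Gamma r * (l powr 1 * l powr (r - 1)) * (x powr (\<alpha> - 1) * (x powr \<alpha>) powr (r - 1)) * exp (- l * x powr \<alpha>)"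
      using x l by (simp add: g_def g'_def gamma_density_def abs_mult powr_mult)
    also have "\<dots> = gg_density r \<alpha> l x"
      unfolding powr_powr powr_add[symmetric] using x by (simp add: gg_density_def algebra_simps)
    finally show ?thesis .
  qed
  have absint: "gamma_density r absolutely_integrable_on g ` S"
  proof (rule set_integrable_subset[of lebesgue UNIV])
    show "set_integrable lebesgue UNIV (gamma_density r)"
      using integrable_gamma_density[OF r] by (simp add: set_integrable_def integrable_completion)
    show "g ` S \<in> sets lebesgue" unfolding img by simp
  qed simp
  then have *: "(\<lambda>x. \<bar>g' x\<bar> * gamma_density r (g x)) absolutely_integrable_on S"
     "integral S (\<lambda>x. \<bar>g' x\<bar> * gamma_density r (g x)) = integral (g ` S) (gamma_density r)"
    using has_absolute_integral_change_of_variables_1'[of S g g' "gamma_density r" "integral (g ` S) (gamma_density r)"] S inj der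
    by auto
  have "((\<lambda>x. \<bar>g' x\<bar> * gamma_density r (g x)) has_integral integral (g ` S) (gamma_density r)) S"
    using * set_lebesgue_integral_eq_integral(1) integrable_integral by metis
  then have "(\<integral>\<^sup>+x. ennreal (\<bar>g' x\<bar> * gamma_density r (g x)) * indicator S x \<partial>lborel) = integral (g ` S) (gamma_density r)"
    using r by (intro nn_integral_has_integral_lebesgue') auto
  moreover have "(gamma_density r has_integral integral (g ` S) (gamma_density r)) (g ` S)"
    using absint set_lebesgue_integral_eq_integral(1) integrable_integral by metis
  then have "(\<integral>\<^sup>+x. ennreal (gamma_density r x) * indicator (g ` S) x \<partial>lborel) = integral (g ` S) (gamma_density r)"
    using r by (intro nn_integral_has_integral_lebesgue') auto
  moreover have "(\<integral>\<^sup>+x. ennreal (\<bar>g' x\<bar> * gamma_density r (g x)) * indicator S x \<partial>lborel) =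
     (\<integral>\<^sup>+x. ennreal (gg_density r \<alpha> l x) * indicator T (l * x powr \<alpha>) \<partial>lborel)"
    using eq by (intro nn_integral_cong) (auto simp: indicator_def S_def gg_density_def)
  moreover have "(\<integral>\<^sup>+x. ennreal (gamma_density r x) * indicator (g ` S) x \<partial>lborel) =
     (\<integral>\<^sup>+u. ennreal (gamma_density r u) * indicator T u \<partial>lborel)"
    unfolding img by (intro nn_integral_cong) (auto simp: indicator_def gamma_density_def)
  ultimately show ?thesis by simp
qed

lemma nn_integral_gg_density:
  assumes "r > 0" "\<alpha> \<noteq> 0" "l > 0"
  shows "(\<integral>\<^sup>+x. ennreal (gg_density r \<alpha> l x) \<partial>lborel) = 1"
  using nn_integral_gg_density_powr[OF assms, of UNIV] nn_integral_gamma_density assms by simp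

lemma integrable_gg_density: "r > 0 \<Longrightarrow> \<alpha> \<noteq> 0 \<Longrightarrow> l > 0 \<Longrightarrow> integrable lborel (gg_density r \<alpha> l)"
  by (intro integrableI_nonneg) (auto simp: nn_integral_gg_density)

lemma real_distribution_gg:
  assumes "r > 0" "\<alpha> \<noteq> 0" "l > 0"
  shows "real_distribution (density lborel (\<lambda>x. ennreal (gg_density r \<alpha> l x)))"
proof -
  have "prob_space (density lborel (\<lambda>x. ennreal (gg_density r \<alpha> l x)))"
    using nn_integral_gg_density[OF assms] by (intro prob_spaceI) (simp add: emeasure_density)
  then show ?thesis
    by (simp add: real_distribution_def real_distribution_axioms_def)
qed

text \<open>Multiplying a variable by \<open>c\<close> multiplies the last parameter by
  \<open>c powr - \<alpha>\<close>. This is used twice: with \<open>c\<close> replaced by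
  \<open>n\<close> it removes \<open>n\<close> from the mixing density, and with the limit constant
  it identifies the limit law.\<close>

lemma gg_density_scale:
  assumes "c > 0"
  shows "gg_density r \<alpha> (c powr - \<alpha>) (c * y) = gg_density r \<alpha> 1 y / c"
proof (cases "y > 0")
  case True
  have "(c powr - \<alpha>) powr r * (c * y) powr (\<alpha> * r - 1) = c powr (- \<alpha> * r + (\<alpha> * r - 1)) * y powr (\<alpha> * r - 1)"
    using assms True by (simp add: powr_mult powr_powr) (simp add: powr_diff powr_minus field_simps)
  also have "\<dots> = y powr (\<alpha> * r - 1) / c"
    using assms by (simp add: powr_minus_divide)
  finally have 1: "(c powr - \<alpha>) powr r * (c * y) powr (\<alpha> * r - 1) = y powr (\<alpha> * r - 1) / c" .
  have 2: "c powr - \<alpha> * (c * y) powr \<alpha> = y powr \<alpha>"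
    using assms True by (simp add: powr_mult powr_minus)
  have "gg_density r \<alpha> (c powr - \<alpha>) (c * y) =
    \<bar>\<alpha>\<bar> / Gamma r * ((c powr - \<alpha>) powr r * (c * y) powr (\<alpha> * r - 1)) * exp (- (c powr - \<alpha> * (c * y) powr \<alpha>))"
    using assms True by (simp add: gg_density_def)
  then show ?thesis unfolding 1 2 using True by (simp add: gg_density_def)
next
  case False
  then show ?thesis using assms by (simp add: gg_density_def zero_less_mult_iff)
qed

section \<open>Poisson averages and their exponential bounds\<close>

lemma Poisson_sums_one: "(\<lambda>k. exp (- l) * l ^ k / fact k :: real) sums 1"
  using sums_mult[OF exp_converges[of l], of "exp (- l)"]
  by (simp add: divide_inverse mult_ac flip: exp_add)

lemma summable_Poisson_mixture:
  fixes b :: "nat \<Rightarrow> real"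
  assumes "0 \<le> l" and b: "\<And>k. 0 \<le> b k" "\<And>k. b k \<le> 1"
  shows "summable (\<lambda>k. exp (- l) * l ^ k / fact k * b k)"
proof (rule summable_comparison_test'[OF sums_summable[OF Poisson_sums_one[of l]], of 0])
  fix k
  have p: "0 \<le> exp (- l) * l ^ k / fact k" using assms by simp
  show "norm (exp (- l) * l ^ k / fact k * b k) \<le> exp (- l) * l ^ k / fact k"
    using mult_left_le[OF b(2) p] abs_of_nonneg[OF mult_nonneg_nonneg[OF p b(1)]]
    unfolding real_norm_def by metis
qed

text \<open>Chernoff's bound with tilt \<open>\<theta> = y' / y\<close>, for both tails of the Poisson law with mean \<open>n * y\<close>.\<close>
lemma Poisson_mixture_le:
  fixes b :: "nat \<Rightarrow> real"
  assumes y: "0 < y" "0 < y'" "y \<noteq> y'" and n: "0 \<le> n" and \<beta>: "0 \<le> \<beta>"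
    and b: "\<And>k. 0 \<le> b k" "\<And>k. b k \<le> 1"
    and b\<beta>: "\<And>k. (real k - n * y') * (y' - y) < 0 \<Longrightarrow> b k \<le> \<beta>"
  shows "(\<Sum>k. exp (- (n * y)) * (n * y) ^ k / fact k * b k) \<le> \<beta> + exp (- n * (y' * ln (y' / y) - y' + y))"
proof -
  define \<theta> where "\<theta> = y' / y"
  have \<theta>: "\<theta> > 0" using y by (simp add: \<theta>_def)
  \<comment> \<open>The sign condition in \<open>b\<beta>\<close> treats both tails at once: where
    it fails, \<open>real k - n * y'\<close> and \<open>ln \<theta>\<close> have a nonnegative
    product, so the tilt is at least 1 and dominates \<open>b k\<close>.\<close>
  have bound: "b k \<le> \<beta> + \<theta> powr (real k - n * y')" for k
  proof (cases "(real k - n * y') * (y' - y) < 0")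
    case True
    then show ?thesis using b\<beta>[of k] by (smt (verit) powr_ge_zero)
  next
    case False
    have "0 \<le> (real k - n * y') * ln \<theta>"
    proof (cases "y' > y")
      case True
      then have "0 \<le> real k - n * y'" using False by (simp add: not_less zero_le_mult_iff)
      then show ?thesis using True y by (intro mult_nonneg_nonneg) (auto simp: \<theta>_def)
    next
      case F: False
      then have "real k - n * y' \<le> 0" using False y by (auto simp: not_less zero_le_mult_iff)
      then show ?thesis using F y by (intro mult_nonpos_nonpos) (auto simp: \<theta>_def ln_div)
    qed
    then have "1 \<le> \<theta> powr (real k - n * y')" using \<theta> by (simp add: powr_def)
    then show ?thesis using b(2)[of k] \<beta> by linarith
  qed
  let ?p = "\<lambda>k. exp (- (n * y)) * (n * y) ^ k / fact k"
  have p: "0 \<le> ?p k" for k using n y by simp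
  \<comment> \<open>The factor \<open>\<theta> ^ k\<close> replaces the mean \<open>n * y\<close> by
    \<open>n * y'\<close>, so the tilted weights again form an exponential series.\<close>
  have tilt: "(\<lambda>k. ?p k * \<theta> powr (real k - n * y')) sums exp (- n * (y' * ln (y' / y) - y' + y))"
  proof -
    have eq: "?p k * \<theta> powr (real k - n * y') = (exp (- (n * y)) * \<theta> powr (- (n * y'))) * ((n * y') ^ k / fact k)" for k
    proof -
      have "\<theta> powr (real k - n * y') = (y' / y) ^ k * \<theta> powr (- (n * y'))"
        using \<theta> by (simp add: \<theta>_def powr_diff powr_minus powr_realpow divide_inverse)
      moreover have "(n * y) ^ k * (y' / y) ^ k = (n * y') ^ k"
        using y by (simp flip: power_mult_distrib)
      ultimately show ?thesis by (simp add: mult_ac)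
    qed
    have "(\<lambda>k. (exp (- (n * y)) * \<theta> powr (- (n * y'))) * ((n * y') ^ k / fact k)) sums
       ((exp (- (n * y)) * \<theta> powr (- (n * y'))) * exp (n * y'))"
      using exp_converges[of "n * y'"] by (intro sums_mult) (simp add: divide_inverse mult.commute)
    moreover have "(exp (- (n * y)) * \<theta> powr (- (n * y'))) * exp (n * y') = exp (- n * (y' * ln (y' / y) - y' + y))"
      using \<theta> y by (simp add: powr_def \<theta>_def algebra_simps flip: exp_add)
    ultimately show ?thesis unfolding eq by simp
  qed
  have "(\<lambda>k. ?p k * (\<beta> + \<theta> powr (real k - n * y'))) sums (1 * \<beta> + exp (- n * (y' * ln (y' / y) - y' + y)))"
    unfolding distrib_left[where a="?p _"] by (intro sums_add tilt sums_mult2 Poisson_sums_one)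
  moreover have "summable (\<lambda>k. ?p k * b k)"
    using n y b by (intro summable_Poisson_mixture) auto
  ultimately have "(\<Sum>k. ?p k * b k) \<le> 1 * \<beta> + exp (- n * (y' * ln (y' / y) - y' + y))"
    by (intro sums_le[OF mult_left_mono[OF bound p] summable_sums])
  then show ?thesis by simp
qed

text \<open>The exponent in Chernoff's bound is the relative entropy of the Poisson law with mean
  \<open>y'\<close> with respect to the one with mean \<open>y\<close>. Its positivity is the strict
  inequality \<open>ln u < u - 1\<close> at \<open>u = y / y'\<close>, strict because
  \<open>u\<close> is not 1.\<close>

lemma Poisson_rate_pos:
  fixes y y' :: real
  assumes "0 < y" "0 < y'" "y \<noteq> y'"
  shows "0 < y' * ln (y' / y) - y' + y"
proof -
  have "ln (y / y') < y / y' - 1"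
    using assms ln_le_minus_one[of "y / y'"] ln_eq_minus_one[of "y / y'"] by force
  then have "y' * ln (y / y') < y' * (y / y' - 1)"
    using assms by (intro mult_strict_left_mono)
  then show ?thesis using assms by (simp add: ln_div algebra_simps)
qed

section \<open>Convergence of the random sums\<close>

text \<open>By monotonicity, the error between two neighbouring grid points is at most a grid error
  plus the oscillation of \<open>F\<close> over one cell. Uniform continuity requires a compact
  interval, hence the cut at \<open>K\<close>, beyond which \<open>F\<close> and eventually
  \<open>H n\<close> lie within \<open>2 * d\<close> of 1.\<close>

lemma Polya_uniform_convergence:
  fixes F :: "real \<Rightarrow> real" and H :: "nat \<Rightarrow> real \<Rightarrow> real"
  assumes contF: "continuous_on {0..} F" and monoF: "\<And>x y. 0 \<le> x \<Longrightarrow> x \<le> y \<Longrightarrow> F x \<le> F y"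
    and F1: "\<And>x. 0 \<le> x \<Longrightarrow> F x \<le> 1" and limF: "(F \<longlongrightarrow> 1) at_top"
    and monoH: "\<And>n x y. 0 \<le> x \<Longrightarrow> x \<le> y \<Longrightarrow> H n x \<le> H n y"
    and H1: "\<And>n x. 0 \<le> x \<Longrightarrow> H n x \<le> 1"
    and lim: "\<And>x. 0 \<le> x \<Longrightarrow> (\<lambda>n. H n x) \<longlonglongrightarrow> F x"
  shows "(\<lambda>n. SUP x\<in>{0..}. \<bar>H n x - F x\<bar>) \<longlonglongrightarrow> 0"
proof (rule LIMSEQ_I)
  fix e :: real assume "e > 0"
  \<comment> \<open>The pointwise error will be at most \<open>2 * d\<close>, so a quarter keeps the
    supremum strictly below \<open>e\<close>.\<close>
  define d where "d = e / 4"
  have d: "d > 0" using \<open>e > 0\<close> by (simp add: d_def)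
  have "\<forall>\<^sub>F x in at_top. F x > 1 - d \<and> x > 0"
    using order_tendstoD(1)[OF limF, of "1 - d"] d by (intro eventually_conj eventually_gt_at_top) auto
  then obtain K where K: "F K > 1 - d" "K > 0"
    using eventually_happens by fastforce
  have "uniformly_continuous_on {0..K} F"
    by (intro compact_uniformly_continuous continuous_on_subset[OF contF]) auto
  then obtain \<delta> where \<delta>: "\<delta> > 0" "\<And>x y. x \<in> {0..K} \<Longrightarrow> y \<in> {0..K} \<Longrightarrow> \<bar>x - y\<bar> < \<delta> \<Longrightarrow> \<bar>F x - F y\<bar> < d"
    using d unfolding uniformly_continuous_on_def dist_real_def by (metis abs_minus_commute)
  obtain m :: nat where m: "real m > K / \<delta>" using reals_Archimedean2 by blast
  have m0: "real m > 0" using m K \<delta> by (meson divide_pos_pos less_trans)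
  define g where "g i = real i * K / real m" for i
  have gm: "g m = K" using m0 by (simp add: g_def)
  have step: "g (Suc i) = g i + K / m" for i using m0 by (simp add: g_def field_simps)
  have h: "K / m < \<delta>" using m m0 \<delta> by (simp add: field_simps)
  have g0: "0 \<le> g i" for i using K by (simp add: g_def)
  have gmono: "i \<le> m \<Longrightarrow> g i \<le> K" for i using K m0 by (simp add: g_def field_simps)
  have "\<forall>\<^sub>F n in sequentially. \<forall>i\<in>{..m}. \<bar>H n (g i) - F (g i)\<bar> < d"
  proof (rule eventually_ball_finite)
    show "\<forall>i\<in>{..m}. \<forall>\<^sub>F n in sequentially. \<bar>H n (g i) - F (g i)\<bar> < d"
      using tendstoD[OF lim[OF g0] d] by (simp add: dist_real_def)
  qed simp
  then obtain n0 where n0: "\<And>n i. n \<ge> n0 \<Longrightarrow> i \<le> m \<Longrightarrow> \<bar>H n (g i) - F (g i)\<bar> < d"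
    by (auto simp: eventually_sequentially)
  have bound: "\<bar>H n x - F x\<bar> \<le> 2 * d" if n: "n \<ge> n0" and x: "x \<ge> 0" for n x
  proof (cases "x \<ge> K")
    case True
    have "H n K \<le> H n x" "F x \<le> 1" "H n x \<le> 1" "F K \<le> F x"
      using True K x monoH F1 H1 monoF by auto
    moreover have "\<bar>H n K - F K\<bar> < d" using n0[OF n, of m] gm by simp
    ultimately show ?thesis using K by linarith
  next
    case False
    define i where "i = nat \<lfloor>x * m / K\<rfloor>"
    have "0 \<le> x * m / K" using x K by simp
    then have i: "real i \<le> x * m / K" "x * m / K < real i + 1" unfolding i_def by linarith+
    have gi: "g i \<le> x" "x \<le> g (Suc i)"
      using i K m0 by (auto simp: g_def field_simps)
    have "real i < real m"
    proof -
      have "x * m / K < m" using False K m0 by (simp add: field_simps)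
      then show ?thesis using i by linarith
    qed
    then have im: "i \<le> m" "Suc i \<le> m" by auto
    have 1: "\<bar>F x - F (g i)\<bar> < d" "\<bar>F (g (Suc i)) - F x\<bar> < d"
      using gi h step[of i] x gmono[OF im(1)] gmono[OF im(2)] g0[of i] g0[of "Suc i"] False
      by (auto intro!: \<delta>(2))
    have "H n (g i) \<le> H n x" "H n x \<le> H n (g (Suc i))"
      using gi g0 x monoH by auto
    then show ?thesis using 1 n0[OF n im(1)] n0[OF n im(2)] by linarith
  qed
  show "\<exists>no. \<forall>n\<ge>no. norm ((SUP x\<in>{0..}. \<bar>H n x - F x\<bar>) - 0) < e"
  proof (intro exI allI impI)
    fix n assume n: "n \<ge> n0"
    have "(SUP x\<in>{0..}. \<bar>H n x - F x\<bar>) \<le> 2 * d"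
      using bound[OF n] by (intro cSUP_least) auto
    \<comment> \<open>The error at 0 shows that the supremum is nonnegative, so the upper bound on
      it also bounds its norm.\<close>
    moreover have "\<bar>H n 0 - F 0\<bar> \<le> (SUP x\<in>{0..}. \<bar>H n x - F x\<bar>)"
    proof (rule cSUP_upper)
      show "bdd_above ((\<lambda>x. \<bar>H n x - F x\<bar>) ` {0..})"
        using bound[OF n] by (intro bdd_aboveI2[of _ _ "2 * d"]) auto
    qed simp
    ultimately show "norm ((SUP x\<in>{0..}. \<bar>H n x - F x\<bar>) - 0) < e"
      using d by (simp add: d_def)
  qed
qed

lemma Poisson_mixture_bounds:
  fixes b :: "nat \<Rightarrow> real"
  assumes l: "0 \<le> l" and b: "\<And>k. 0 \<le> b k" "\<And>k. b k \<le> 1"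
  shows "0 \<le> (\<Sum>k. exp (- l) * l ^ k / fact k * b k)"
    "(\<Sum>k. exp (- l) * l ^ k / fact k * b k) \<le> 1"
proof -
  have nn: "0 \<le> exp (- l) * l ^ k / fact k" for k using l by simp
  show "0 \<le> (\<Sum>k. exp (- l) * l ^ k / fact k * b k)"
    by (intro suminf_nonneg summable_Poisson_mixture assms mult_nonneg_nonneg nn)
  show "(\<Sum>k. exp (- l) * l ^ k / fact k * b k) \<le> 1"
    by (intro sums_le[OF _ summable_sums[OF summable_Poisson_mixture[OF assms]] Poisson_sums_one[of l]]
         mult_left_le b nn)
qed

text \<open>The Poisson law with mean \<open>n * y\<close> concentrates on the side of
  \<open>n * y'\<close> that contains \<open>n * y\<close>. On that side \<open>anti\<close>
  compares every \<open>p n k\<close> with the value at the integer part of \<open>n * y'\<close>,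
  whose limit is known since \<open>c * y'\<close> lies on the same side of \<open>x\<close> as
  \<open>c * y\<close>. The excluded equality concerns a single \<open>y\<close>, hence a null set
  in the later integral.\<close>

lemma Poisson_mixture_tendsto:
  fixes p :: "nat \<Rightarrow> nat \<Rightarrow> real"
  assumes c: "c > 0" and x: "x \<ge> 0" and y: "y > 0" and ne: "c * y \<noteq> x"
    and p: "\<And>n k. 0 \<le> p n k" "\<And>n k. p n k \<le> 1"
    and anti: "\<And>n k m. k \<le> m \<Longrightarrow> p n m \<le> p n k"
    and lim1: "\<And>y'. y' > 0 \<Longrightarrow> c * y' < x \<Longrightarrow> (\<lambda>n. p n (nat \<lfloor>real n * y'\<rfloor>)) \<longlonglongrightarrow> 1"
    and lim0: "\<And>y'. y' > 0 \<Longrightarrow> x < c * y' \<Longrightarrow> (\<lambda>n. p n (nat \<lfloor>real n * y'\<rfloor>)) \<longlonglongrightarrow> 0"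
  shows "(\<lambda>n. \<Sum>k. exp (- (real n * y)) * (real n * y) ^ k / fact k * p n k) \<longlonglongrightarrow> (if c * y < x then 1 else 0)"
proof -
  \<comment> \<open>The midpoint of \<open>y\<close> and \<open>x / c\<close>, so that it separates
    them strictly.\<close>
  define y' where "y' = (y + x / c) / 2"
  have "x / c \<ge> 0" using c x by simp
  then have y': "y' > 0" using y by (simp add: y'_def add_pos_nonneg)
  have "y \<noteq> y'" using c ne by (auto simp: y'_def field_simps)
  note y' = y' this
  define I where "I = y' * ln (y' / y) - y' + y"
  have I: "I > 0" unfolding I_def using Poisson_rate_pos y y' by blast
  have expI: "(\<lambda>n. exp (- real n * I)) \<longlonglongrightarrow> 0" using I by real_asymp
  define Q where "Q n b = (\<Sum>k. exp (- (real n * y)) * (real n * y) ^ k / fact k * b k)" for n :: nat and b :: "nat \<Rightarrow> real"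
  let ?m = "\<lambda>n. nat \<lfloor>real n * y'\<rfloor>"
  have m: "k \<le> ?m n" if "real k < real n * y'" for k n
    using that by (simp add: le_nat_floor)
  have m': "?m n \<le> k" if "real n * y' < real k" for k n
    using that y' by linarith
  show ?thesis
  proof (cases "c * y < x")
    case True
    then have yy: "y < y'" "c * y' < x" using c by (auto simp: y'_def field_simps)
    \<comment> \<open>\<open>Poisson_mixture_le\<close> gives only upper bounds; the lower bound for
      the average of \<open>p n\<close> comes from applying it to the complement
      \<open>1 - p n k\<close>.\<close>
    have Q1: "Q n (\<lambda>k. 1 - p n k) = 1 - Q n (p n)" for n
    proof -
      have "(\<lambda>k. exp (- (real n * y)) * (real n * y) ^ k / fact k - exp (- (real n * y)) * (real n * y) ^ k / fact k * p n k) sums (1 - Q n (p n))"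
        unfolding Q_def using p y by (intro sums_diff Poisson_sums_one summable_sums summable_Poisson_mixture) auto
      then show ?thesis by (simp add: Q_def sums_iff right_diff_distrib diff_divide_distrib)
    qed
    have "Q n (\<lambda>k. 1 - p n k) \<le> (1 - p n (?m n)) + exp (- real n * I)" for n
      unfolding I_def Q_def
    proof (intro Poisson_mixture_le)
      fix k assume "(real k - real n * y') * (y' - y) < 0"
      then have "real k < real n * y'" using yy by (simp add: mult_less_0_iff)
      then show "1 - p n k \<le> 1 - p n (?m n)" using anti[OF m] by simp
    qed (use y y' p in auto)
    then have upper: "1 - Q n (p n) \<le> (1 - p n (?m n)) + exp (- real n * I)" for n
      unfolding Q1 .
    have "p n (?m n) - exp (- real n * I) \<le> Q n (p n)" for n
      using upper[of n] by linarith
    moreover have "(\<lambda>n. p n (?m n) - exp (- real n * I)) \<longlonglongrightarrow> 1 - 0"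
      using y' yy by (intro tendsto_diff lim1 expI) auto
    moreover have "Q n (p n) \<le> 1" for n
      unfolding Q_def using p y by (intro Poisson_mixture_bounds) auto
    ultimately have "(\<lambda>n. Q n (p n)) \<longlonglongrightarrow> 1"
      by - (rule tendsto_sandwich[of "\<lambda>n. p n (?m n) - exp (- real n * I)" _ _ "\<lambda>_. 1"], simp_all)
    then show ?thesis using True by (simp add: Q_def)
  next
    case False
    then have yy: "y' < y" "x < c * y'" using c ne by (auto simp: y'_def field_simps)
    have "Q n (p n) \<le> p n (?m n) + exp (- real n * I)" for n
      unfolding I_def Q_def
    proof (intro Poisson_mixture_le)
      fix k assume "(real k - real n * y') * (y' - y) < 0"
      then have "real n * y' < real k" using yy by (simp add: mult_less_0_iff)
      then show "p n k \<le> p n (?m n)" using anti[OF m'] by simp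
    qed (use y y' p in auto)
    moreover have "(\<lambda>n. p n (?m n) + exp (- real n * I)) \<longlonglongrightarrow> 0 + 0"
      using y' yy by (intro tendsto_add lim0 expI) auto
    moreover have "0 \<le> Q n (p n)" for n
      unfolding Q_def using p y by (intro Poisson_mixture_bounds) auto
    ultimately have "(\<lambda>n. Q n (p n)) \<longlonglongrightarrow> 0"
      by - (rule tendsto_sandwich[of "\<lambda>_. 0" _ _ "\<lambda>n. p n (?m n) + exp (- real n * I)"], simp_all)
    then show ?thesis using False by (simp add: Q_def)
  qed
qed

section \<open>From the almost sure law of large numbers to limits of probabilities\<close>

lemma (in prob_space) prob_tendsto_1:
  assumes A [measurable]: "\<And>n::nat. A n \<in> events" and ev: "AE \<omega> in M. \<forall>\<^sub>F n in sequentially. \<omega> \<in> A n"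
  shows "(\<lambda>n. prob (A n)) \<longlonglongrightarrow> 1"
proof -
  have "(\<lambda>n. \<integral>\<omega>. indicator (A n) \<omega> \<partial>M) \<longlonglongrightarrow> (\<integral>\<omega>. (1::real) \<partial>M)"
  proof (rule integral_dominated_convergence[where w="\<lambda>_. 1"])
    show "AE \<omega> in M. (\<lambda>n. indicator (A n) \<omega> :: real) \<longlonglongrightarrow> 1"
      using ev by eventually_elim (auto intro!: tendsto_eventually elim!: eventually_mono)
  qed auto
  then show ?thesis by (simp add: prob_space)
qed

lemma (in prob_space) prob_partial_sum_less_tendsto:
  fixes X :: "nat \<Rightarrow> 'a \<Rightarrow> real"
  assumes X [measurable]: "\<And>i. X i \<in> borel_measurable M"
    and slln: "AE \<omega> in M. (\<lambda>n. (\<Sum>j<n. X j \<omega>) / real n) \<longlonglongrightarrow> c"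
    and y: "y > 0"
  shows "c * y < x \<Longrightarrow> (\<lambda>n. prob {\<omega> \<in> space M. (\<Sum>j<nat \<lfloor>real n * y\<rfloor>. X j \<omega>) < real n * x}) \<longlonglongrightarrow> 1"
    and "x < c * y \<Longrightarrow> (\<lambda>n. prob {\<omega> \<in> space M. (\<Sum>j<nat \<lfloor>real n * y\<rfloor>. X j \<omega>) < real n * x}) \<longlonglongrightarrow> 0"
proof -
  let ?m = "\<lambda>n. nat \<lfloor>real n * y\<rfloor>"
  let ?A = "\<lambda>n. {\<omega> \<in> space M. (\<Sum>j<?m n. X j \<omega>) < real n * x}"
  have m: "filterlim ?m at_top sequentially" using y by real_asymp
  have mn: "(\<lambda>n. real (?m n) / real n) \<longlonglongrightarrow> y" using y by real_asymp
  have conv: "AE \<omega> in M. (\<lambda>n. (\<Sum>j<?m n. X j \<omega>) / real n) \<longlonglongrightarrow> c * y"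
    using slln
  proof eventually_elim
    fix \<omega> assume *: "(\<lambda>n. (\<Sum>j<n. X j \<omega>) / real n) \<longlonglongrightarrow> c"
    have "(\<lambda>n. (\<Sum>j<?m n. X j \<omega>) / real (?m n) * (real (?m n) / real n)) \<longlonglongrightarrow> c * y"
      by (intro tendsto_mult mn filterlim_compose[OF * m])
    \<comment> \<open>For \<open>k = 0\<close> both sides are 0: the sum is empty and division by
      zero yields zero.\<close>
    moreover have "(\<Sum>j<k. X j \<omega>) / real k * (real k / real n) = (\<Sum>j<k. X j \<omega>) / real n" for k n
      by (cases "k = 0") auto
    ultimately show "(\<lambda>n. (\<Sum>j<?m n. X j \<omega>) / real n) \<longlonglongrightarrow> c * y" by (simp only:)
  qed
  {
    assume "c * y < x"
    have "AE \<omega> in M. \<forall>\<^sub>F n in sequentially. \<omega> \<in> ?A n"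
      using conv AE_space
    proof eventually_elim
      case (elim \<omega>)
      show ?case
        using order_tendstoD(2)[OF elim(1) \<open>c * y < x\<close>] eventually_gt_at_top[of 0]
        by eventually_elim (use elim(2) in \<open>auto simp: field_simps\<close>)
    qed
    then show "(\<lambda>n. prob (?A n)) \<longlonglongrightarrow> 1" by (intro prob_tendsto_1) auto
  next
    assume "x < c * y"
    have "AE \<omega> in M. \<forall>\<^sub>F n in sequentially. \<omega> \<in> space M - ?A n"
      using conv AE_space
    proof eventually_elim
      case (elim \<omega>)
      show ?case
        using order_tendstoD(1)[OF elim(1) \<open>x < c * y\<close>] eventually_gt_at_top[of 0]
        by eventually_elim (use elim(2) in \<open>auto simp: field_simps\<close>)
    qed
    then have "(\<lambda>n. prob (space M - ?A n)) \<longlonglongrightarrow> 1" by (intro prob_tendsto_1) auto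
    then have "(\<lambda>n. 1 - prob (space M - ?A n)) \<longlonglongrightarrow> 1 - 1" by (intro tendsto_intros)
    moreover have "1 - prob (space M - ?A n) = prob (?A n)" for n
      by (subst prob_compl) auto
    ultimately show "(\<lambda>n. prob (?A n)) \<longlonglongrightarrow> 0" by simp
  }
qed

text \<open>The substitution \<open>z = n * y\<close> turns the mixing density with parameter \<open>n powr - \<alpha>\<close> into the
  one with parameter 1, independently of \<open>n\<close>.\<close>
lemma gnb_pmf_eq_nn_integral:
  assumes r: "r > 0" and \<alpha>: "\<alpha> \<noteq> 0" and n: "n \<ge> 1"
  shows "ennreal (gnb_pmf r \<alpha> (real n powr (- \<alpha>)) k) =
    (\<integral>\<^sup>+y. ennreal (gg_density r \<alpha> 1 y * (exp (- (real n * y)) * (real n * y) ^ k / fact k)) \<partial>lborel)"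
proof -
  let ?g = "gg_density r \<alpha> (real n powr (- \<alpha>))"
  let ?f = "\<lambda>z. exp (- z) * z ^ k / fact k * ?g z"
  have nn: "0 \<le> ?f z" for z
    using r by (cases "z > 0") (auto simp: gg_density_def)
  have le: "exp (- z) * z ^ k / fact k \<le> 1" if "z > 0" for z :: real
    using sums_le[OF _ sums_single[of k "\<lambda>k. exp (- z) * z ^ k / fact k"] Poisson_sums_one[of z]] that
    by auto
  \<comment> \<open>\<open>gnb_pmf\<close> is a Bochner integral, which is 0 by convention on
    nonintegrable functions. Integrability, from the bound of Poisson weights by 1, is what allows
    it to be read as a nonnegative integral.\<close>
  have int: "integrable lborel ?f"
  proof (rule Bochner_Integration.integrable_bound)
    show "integrable lborel ?g" using r \<alpha> n by (intro integrable_gg_density) auto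
    show "AE z in lborel. norm (?f z) \<le> norm (?g z)"
    proof (rule AE_I2)
      fix z
      show "norm (?f z) \<le> norm (?g z)"
      proof (cases "z > 0")
        case True
        then show ?thesis using le[OF True] nn[of z] r mult_right_mono[OF le[OF True], of "?g z"] by auto
      qed (simp add: gg_density_def)
    qed
  qed auto
  have "gnb_pmf r \<alpha> (real n powr (- \<alpha>)) k = (\<integral>z. 1 / fact k * (exp (- z) * z ^ k * ?g z) \<partial>lborel)"
    unfolding gnb_pmf_def by simp
  also have "\<dots> = (\<integral>z. ?f z \<partial>lborel)" by simp
  finally have "ennreal (gnb_pmf r \<alpha> (real n powr (- \<alpha>)) k) = (\<integral>\<^sup>+z. ennreal (?f z) \<partial>lborel)"
    using int nn by (simp add: nn_integral_eq_integral)
  also have "\<dots> = ennreal \<bar>real n\<bar> * (\<integral>\<^sup>+y. ennreal (?f (0 + real n * y)) \<partial>lborel)"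
    using n by (intro nn_integral_real_affine) auto
  also have "\<dots> = (\<integral>\<^sup>+y. ennreal \<bar>real n\<bar> * ennreal (?f (0 + real n * y)) \<partial>lborel)"
    by (subst nn_integral_cmult) auto
  also have "\<dots> = (\<integral>\<^sup>+y. ennreal (gg_density r \<alpha> 1 y * (exp (- (real n * y)) * (real n * y) ^ k / fact k)) \<partial>lborel)"
    using n by (intro nn_integral_cong) (simp add: gg_density_scale mult.commute[of "gg_density _ _ _ _"] flip: ennreal_mult')
  finally show ?thesis .
qed

lemma (in prob_space) emeasure_random_sum_less:
  fixes X :: "nat \<Rightarrow> 'a \<Rightarrow> real" and N :: "'a \<Rightarrow> nat"
  assumes X [measurable]: "\<And>i. X i \<in> borel_measurable M" and N [measurable]: "N \<in> measurable M (count_space UNIV)"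
    and indep: "indep_set
          (sigma_sets (space M) {N -` A \<inter> space M | A. A \<in> sets (count_space UNIV)})
          (sigma_sets (space M) (\<Union>i. {X i -` A \<inter> space M | A. A \<in> sets borel}))"
  shows "emeasure M {\<omega> \<in> space M. (\<Sum>j<N \<omega>. X j \<omega>) < t} =
    (\<Sum>k. ennreal (prob {\<omega> \<in> space M. N \<omega> = k} * prob {\<omega> \<in> space M. (\<Sum>j<k. X j \<omega>) < t}))"
proof -
  let ?G = "\<Union>i. {X i -` A \<inter> space M | A. A \<in> sets borel}"
  let ?S = "\<lambda>k. {\<omega> \<in> space M. (\<Sum>j<k. X j \<omega>) < t}"
  let ?N = "\<lambda>k. {\<omega> \<in> space M. N \<omega> = k}"
  \<comment> \<open>Independence is assumed between generated sigma-algebras. The event about the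
    partial sum has to be placed in the one generated by all \<open>X i\<close>, so each
    \<open>X i\<close> is first made measurable for it.\<close>
  have XG: "X i \<in> borel_measurable (sigma (space M) ?G)" for i
    by (rule measurableI) (auto simp: space_measure_of_conv intro!: in_measure_of)
  have S: "?S k \<in> sigma_sets (space M) ?G" for k
  proof -
    have "(\<lambda>\<omega>. \<Sum>j<k. X j \<omega>) \<in> borel_measurable (sigma (space M) ?G)"
      using XG by simp
    then have "(\<lambda>\<omega>. \<Sum>j<k. X j \<omega>) -` {..<t} \<inter> space (sigma (space M) ?G) \<in> sets (sigma (space M) ?G)"
      by (rule measurable_sets) simp
    moreover have "?G \<subseteq> Pow (space M)" by auto
    moreover have "(\<lambda>\<omega>. \<Sum>j<k. X j \<omega>) -` {..<t} \<inter> space M = ?S k" by auto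
    ultimately show ?thesis by (simp add: sets_measure_of)
  qed
  have Nk: "?N k \<in> sigma_sets (space M) {N -` A \<inter> space M | A. A \<in> sets (count_space UNIV)}" for k
    by (rule sigma_sets.Basic) (auto intro!: exI[of _ "{k}"])
  have "{\<omega> \<in> space M. (\<Sum>j<N \<omega>. X j \<omega>) < t} = (\<Union>k. ?N k \<inter> ?S k)" by auto
  also have "emeasure M \<dots> = (\<Sum>k. emeasure M (?N k \<inter> ?S k))"
    by (rule suminf_emeasure[symmetric]) (auto simp: disjoint_family_on_def)
  also have "\<dots> = (\<Sum>k. ennreal (prob (?N k) * prob (?S k)))"
    using indep_setD[OF indep Nk S] by (simp add: emeasure_eq_measure)
  finally show ?thesis .
qed

text \<open>Splitting by the value of \<open>N n\<close> and inserting the Poisson mixture gives an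
  exact formula whose density factor \<open>?g\<close> is free of \<open>n\<close> and serves as
  dominating function. The limiting integrand is \<open>?g\<close> cut at \<open>x / c\<close>;
  rescaling by \<open>c\<close> turns its integral into the distribution function. Nonnegative
  extended integrals let sum and integral be exchanged without integrability conditions.\<close>

lemma (in prob_space) gnb_random_sum_cdf_tendsto:
  fixes X :: "nat \<Rightarrow> 'a \<Rightarrow> real" and N :: "nat \<Rightarrow> 'a \<Rightarrow> nat"
  assumes X [measurable]: "\<And>i. X i \<in> borel_measurable M"
    and nonneg: "\<And>j \<omega>. \<omega> \<in> space M \<Longrightarrow> X j \<omega> \<ge> 0"
    and c: "0 < c"
    and slln: "AE \<omega> in M. (\<lambda>n. (\<Sum>j<n. X j \<omega>) / real n) \<longlonglongrightarrow> c"
    and r: "0 < r" and \<alpha>: "\<alpha> \<noteq> 0"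
    and N [measurable]: "\<And>n. N n \<in> measurable M (count_space UNIV)"
    and N_distr: "\<And>n k. n \<ge> 1 \<Longrightarrow>
        prob {\<omega> \<in> space M. N n \<omega> = k} = gnb_pmf r \<alpha> (real n powr (- \<alpha>)) k"
    and N_indep: "\<And>n. n \<ge> 1 \<Longrightarrow> indep_set
          (sigma_sets (space M) {N n -` A \<inter> space M | A. A \<in> sets (count_space UNIV)})
          (sigma_sets (space M) (\<Union>i. {X i -` A \<inter> space M | A. A \<in> sets borel}))"
    and x: "0 \<le> x"
  shows "(\<lambda>n. prob {\<omega> \<in> space M. (\<Sum>j<N n \<omega>. X j \<omega>) < real n * x}) \<longlonglongrightarrow>
    cdf (density lborel (\<lambda>x. ennreal (gg_density r \<alpha> (c powr (- \<alpha>)) x))) x"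
proof -
  define p where "p n k = prob {\<omega> \<in> space M. (\<Sum>j<k. X j \<omega>) < real n * x}" for n k
  let ?po = "\<lambda>n y k. exp (- (real n * y)) * (real n * y) ^ k / fact k"
  let ?Q = "\<lambda>n y. \<Sum>k. ?po n y k * p n k"
  let ?g = "gg_density r \<alpha> 1"
  let ?D = "density lborel (\<lambda>x. ennreal (gg_density r \<alpha> (c powr (- \<alpha>)) x))"
  interpret D: real_distribution ?D using real_distribution_gg r \<alpha> c by simp
  have p01: "0 \<le> p n k" "p n k \<le> 1" for n k by (auto simp: p_def)
  have anti: "p n m \<le> p n k" if "k \<le> m" for n k m
    unfolding p_def
  proof (rule finite_measure_mono)
    have "(\<Sum>j<k. X j \<omega>) \<le> (\<Sum>j<m. X j \<omega>)" if "\<omega> \<in> space M" for \<omega>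
      using \<open>k \<le> m\<close> nonneg[OF that] by (intro sum_mono2) auto
    then show "{\<omega> \<in> space M. (\<Sum>j<m. X j \<omega>) < real n * x} \<subseteq> {\<omega> \<in> space M. (\<Sum>j<k. X j \<omega>) < real n * x}"
      by (auto intro: le_less_trans)
  qed auto
  have em: "emeasure M {\<omega> \<in> space M. (\<Sum>j<N n \<omega>. X j \<omega>) < real n * x} =
     (\<integral>\<^sup>+y. ennreal (?g y * ?Q n y) \<partial>lborel)" if n: "n \<ge> 1" for n
  proof -
    have "emeasure M {\<omega> \<in> space M. (\<Sum>j<N n \<omega>. X j \<omega>) < real n * x} =
      (\<Sum>k. ennreal (gnb_pmf r \<alpha> (real n powr (- \<alpha>)) k) * ennreal (p n k))"
      using p01 by (subst emeasure_random_sum_less[OF X N N_indep[OF n]])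
         (simp add: N_distr[OF n, symmetric] p_def ennreal_mult)
    also have "\<dots> = (\<Sum>k. \<integral>\<^sup>+y. ennreal (?g y * ?po n y k) * ennreal (p n k) \<partial>lborel)"
      by (subst gnb_pmf_eq_nn_integral[OF r \<alpha> n], subst nn_integral_multc) auto
    also have "\<dots> = (\<integral>\<^sup>+y. (\<Sum>k. ennreal (?g y * ?po n y k) * ennreal (p n k)) \<partial>lborel)"
      by (intro nn_integral_suminf[symmetric]) auto
    also have "\<dots> = (\<integral>\<^sup>+y. ennreal (?g y * ?Q n y) \<partial>lborel)"
    proof (rule nn_integral_cong)
      fix y
      show "(\<Sum>k. ennreal (?g y * ?po n y k) * ennreal (p n k)) = ennreal (?g y * ?Q n y)"
      proof (cases "y > 0")
        case True
        have sm: "summable (\<lambda>k. ?po n y k * p n k)"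
          using True p01 by (intro summable_Poisson_mixture) auto
        have "(\<Sum>k. ennreal (?g y * ?po n y k) * ennreal (p n k)) = (\<Sum>k. ennreal (?g y * (?po n y k * p n k)))"
          using p01 r True by (intro suminf_cong) (simp add: mult.assoc flip: ennreal_mult')
        also have "\<dots> = ennreal (\<Sum>k. ?g y * (?po n y k * p n k))"
          using p01 r True sm by (intro suminf_ennreal2 summable_mult) auto
        also have "(\<Sum>k. ?g y * (?po n y k * p n k)) = ?g y * ?Q n y"
          using sm by (rule suminf_mult)
        finally show ?thesis .
      qed (simp add: gg_density_def)
    qed
    finally show ?thesis .
  qed
  have lim: "(\<lambda>n. \<integral>\<^sup>+y. ennreal (?g y * ?Q n y) \<partial>lborel) \<longlonglongrightarrow>
      (\<integral>\<^sup>+y. ennreal (?g y * (if c * y < x then 1 else 0)) \<partial>lborel)"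
  proof (rule nn_integral_dominated_convergence[where w="\<lambda>y. ennreal (?g y)"])
    show "AE y in lborel. ennreal (?g y * ?Q n y) \<le> ennreal (?g y)" for n
    proof (rule AE_I2)
      fix y
      show "ennreal (?g y * ?Q n y) \<le> ennreal (?g y)"
      proof (cases "y > 0")
        case True
        then show ?thesis using p01 r
          by (intro ennreal_leI mult_left_le Poisson_mixture_bounds) auto
      qed (simp add: gg_density_def)
    qed
    show "(\<integral>\<^sup>+y. ennreal (?g y) \<partial>lborel) < \<infinity>"
      using nn_integral_gg_density[OF r \<alpha>] by simp
    show "AE y in lborel. (\<lambda>n. ennreal (?g y * ?Q n y)) \<longlonglongrightarrow> ennreal (?g y * (if c * y < x then 1 else 0))"
      using AE_lborel_singleton[of "x / c"]
    proof eventually_elim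
      fix y assume y: "y \<noteq> x / c"
      show "(\<lambda>n. ennreal (?g y * ?Q n y)) \<longlonglongrightarrow> ennreal (?g y * (if c * y < x then 1 else 0))"
      proof (cases "y > 0")
        case True
        have "(\<lambda>n. ?Q n y) \<longlonglongrightarrow> (if c * y < x then 1 else 0)"
        proof (rule Poisson_mixture_tendsto[OF c x True _ p01 anti])
          show "c * y \<noteq> x" using y c by (auto simp: field_simps)
        qed (auto simp: p_def intro!: prob_partial_sum_less_tendsto[OF X slln])
        then show ?thesis by (intro tendsto_ennrealI tendsto_mult tendsto_const)
      qed (simp add: gg_density_def)
    qed
  qed auto
  have "(\<integral>\<^sup>+y. ennreal (?g y * (if c * y < x then 1 else 0)) \<partial>lborel) = ennreal (cdf ?D x)"
  proof -
    have "ennreal (cdf ?D x) = emeasure ?D {..x}"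
      by (simp add: cdf_def D.emeasure_eq_measure)
    also have "\<dots> = (\<integral>\<^sup>+z. ennreal (gg_density r \<alpha> (c powr (- \<alpha>)) z) * indicator {..x} z \<partial>lborel)"
      by (simp add: emeasure_density)
    also have "\<dots> = ennreal \<bar>c\<bar> * (\<integral>\<^sup>+y. ennreal (gg_density r \<alpha> (c powr (- \<alpha>)) (0 + c * y)) * indicator {..x} (0 + c * y) \<partial>lborel)"
      using c by (intro nn_integral_real_affine) auto
    also have "\<dots> = (\<integral>\<^sup>+y. ennreal \<bar>c\<bar> * (ennreal (gg_density r \<alpha> (c powr (- \<alpha>)) (0 + c * y)) * indicator {..x} (0 + c * y)) \<partial>lborel)"
      by (subst nn_integral_cmult) auto
    also have "\<dots> = (\<integral>\<^sup>+y. ennreal (?g y * (if c * y < x then 1 else 0)) \<partial>lborel)"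
    proof (rule nn_integral_cong_AE)
      show "AE y in lborel. ennreal \<bar>c\<bar> * (ennreal (gg_density r \<alpha> (c powr (- \<alpha>)) (0 + c * y)) * indicator {..x} (0 + c * y)) =
         ennreal (?g y * (if c * y < x then 1 else 0))"
        using AE_lborel_singleton[of "x / c"]
      proof eventually_elim
        fix y assume "y \<noteq> x / c"
        then have "c * y \<noteq> x" using c by (auto simp: field_simps)
        then show "ennreal \<bar>c\<bar> * (ennreal (gg_density r \<alpha> (c powr (- \<alpha>)) (0 + c * y)) * indicator {..x} (0 + c * y)) =
         ennreal (?g y * (if c * y < x then 1 else 0))"
          using c by (auto simp: gg_density_scale indicator_def simp flip: ennreal_mult')
      qed
    qed
    finally show ?thesis by simp
  qed
  with lim have "(\<lambda>n. \<integral>\<^sup>+y. ennreal (?g y * ?Q n y) \<partial>lborel) \<longlonglongrightarrow> ennreal (cdf ?D x)" by simp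
  then have "(\<lambda>n. ennreal (prob {\<omega> \<in> space M. (\<Sum>j<N n \<omega>. X j \<omega>) < real n * x})) \<longlonglongrightarrow> ennreal (cdf ?D x)"
  proof (rule Lim_transform_eventually)
    show "\<forall>\<^sub>F n in sequentially. (\<integral>\<^sup>+y. ennreal (?g y * ?Q n y) \<partial>lborel) =
      ennreal (prob {\<omega> \<in> space M. (\<Sum>j<N n \<omega>. X j \<omega>) < real n * x})"
      using eventually_ge_at_top[of 1] by eventually_elim (simp only: em[symmetric] emeasure_eq_measure)
  qed
  then show ?thesis
    by (rule tendsto_ennrealD) (auto simp: D.cdf_nonneg)
qed

lemma gg_cdf_eq_interval_integral:
  assumes "r > 0" "\<alpha> \<noteq> 0" "l > 0" "x \<ge> 0"
  shows "cdf (density lborel (\<lambda>x. ennreal (gg_density r \<alpha> l x))) x = (LBINT z=0..x. gg_density r \<alpha> l z)"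
proof -
  have "cdf (density lborel (\<lambda>x. ennreal (gg_density r \<alpha> l x))) x = (\<integral>z. indicator {..x} z * gg_density r \<alpha> l z \<partial>lborel)"
  proof -
    have "emeasure (density lborel (\<lambda>x. ennreal (gg_density r \<alpha> l x))) {..x} = (\<integral>\<^sup>+z. ennreal (indicator {..x} z * gg_density r \<alpha> l z) \<partial>lborel)"
      by (subst emeasure_density) (auto intro!: nn_integral_cong simp: indicator_def)
    also have "\<dots> = ennreal (\<integral>z. indicator {..x} z * gg_density r \<alpha> l z \<partial>lborel)"
      using integrable_gg_density[OF assms(1-3)] integrable_real_mult_indicator[of "{..x}" lborel "gg_density r \<alpha> l"] assms
      by (intro nn_integral_eq_integral) (auto simp: mult.commute)
    finally show ?thesis
      using assms by (simp add: cdf_def measure_def)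
  qed
  \<comment> \<open>\<open>einterval\<close> is open, so the indicators differ only at
    \<open>x\<close> and on \<open>z \<le> 0\<close>, where the density vanishes.\<close>
  also have "\<dots> = (\<integral>z. indicator (einterval 0 (ereal x)) z * gg_density r \<alpha> l z \<partial>lborel)"
  proof (rule integral_cong_AE)
    show "AE z in lborel. indicator {..x} z * gg_density r \<alpha> l z = indicator (einterval 0 (ereal x)) z * gg_density r \<alpha> l z"
      using AE_lborel_singleton[of x]
      by eventually_elim (auto simp: indicator_def einterval_def gg_density_def)
  qed auto
  also have "\<dots> = (LBINT z=0..x. gg_density r \<alpha> l z)"
    using assms by (simp add: interval_lebesgue_integral_def set_lebesgue_integral_def zero_ereal_def)
  finally show ?thesis .
qed

lemma (in prob_space) gnb_random_sum_uniform:
  fixes X :: "nat \<Rightarrow> 'a \<Rightarrow> real" and N :: "nat \<Rightarrow> 'a \<Rightarrow> nat"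
  assumes X [measurable]: "\<And>i. X i \<in> borel_measurable M"
    and nonneg: "\<And>j \<omega>. \<omega> \<in> space M \<Longrightarrow> X j \<omega> \<ge> 0"
    and c: "0 < c"
    and slln: "AE \<omega> in M. (\<lambda>n. (\<Sum>j<n. X j \<omega>) / real n) \<longlonglongrightarrow> c"
    and r: "0 < r" and \<alpha>: "\<alpha> \<noteq> 0"
    and N [measurable]: "\<And>n. N n \<in> measurable M (count_space UNIV)"
    and N_distr: "\<And>n k. n \<ge> 1 \<Longrightarrow>
        prob {\<omega> \<in> space M. N n \<omega> = k} = gnb_pmf r \<alpha> (real n powr (- \<alpha>)) k"
    and N_indep: "\<And>n. n \<ge> 1 \<Longrightarrow> indep_set
          (sigma_sets (space M) {N n -` A \<inter> space M | A. A \<in> sets (count_space UNIV)})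
          (sigma_sets (space M) (\<Union>i. {X i -` A \<inter> space M | A. A \<in> sets borel}))"
  shows "(\<lambda>n. SUP x\<in>{0..}. \<bar>prob {\<omega> \<in> space M. (\<Sum>j<N n \<omega>. X j \<omega>) < real n * x}
              - (LBINT z=0..x. gg_density r \<alpha> (c powr (- \<alpha>)) z)\<bar>) \<longlonglongrightarrow> 0"
proof -
  let ?D = "density lborel (\<lambda>x. ennreal (gg_density r \<alpha> (c powr (- \<alpha>)) x))"
  interpret D: real_distribution ?D using real_distribution_gg r \<alpha> c by simp
  have "measure ?D {x} = 0" for x
    by (simp add: measure_def emeasure_density)
  then have "continuous_on {0..} (cdf ?D)"
    by (intro continuous_at_imp_continuous_on ballI) (simp only: D.isCont_cdf)
  then have "(\<lambda>n. SUP x\<in>{0..}. \<bar>prob {\<omega> \<in> space M. (\<Sum>j<N n \<omega>. X j \<omega>) < real n * x} - cdf ?D x\<bar>) \<longlonglongrightarrow> 0"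
  proof (rule Polya_uniform_convergence)
    fix n :: nat and x y :: real assume "x \<le> y"
    then have "real n * x \<le> real n * y" by (intro mult_left_mono) auto
    then show "prob {\<omega> \<in> space M. (\<Sum>j<N n \<omega>. X j \<omega>) < real n * x} \<le> prob {\<omega> \<in> space M. (\<Sum>j<N n \<omega>. X j \<omega>) < real n * y}"
      by (intro finite_measure_mono) auto
  next
    fix x :: real assume "0 \<le> x"
    then show "(\<lambda>n. prob {\<omega> \<in> space M. (\<Sum>j<N n \<omega>. X j \<omega>) < real n * x}) \<longlonglongrightarrow> cdf ?D x"
      by (intro gnb_random_sum_cdf_tendsto assms)
  qed (auto simp: D.cdf_nondecreasing D.cdf_bounded_prob D.cdf_lim_at_top_prob)
  moreover have "(SUP x\<in>{0..}. \<bar>prob {\<omega> \<in> space M. (\<Sum>j<N n \<omega>. X j \<omega>) < real n * x} - cdf ?D x\<bar>) =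
    (SUP x\<in>{0..}. \<bar>prob {\<omega> \<in> space M. (\<Sum>j<N n \<omega>. X j \<omega>) < real n * x}
              - (LBINT z=0..x. gg_density r \<alpha> (c powr (- \<alpha>)) z)\<bar>)" for n
    using gg_cdf_eq_interval_integral r \<alpha> c by (intro SUP_cong) auto
  ultimately show ?thesis by simp
qed

section \<open>Bounded holomorphic functions on the upper half plane\<close>

lemma has_bochner_integral_Cauchy_kernel:
  fixes v :: real
  assumes "v > 0"
  shows "has_bochner_integral lborel (\<lambda>t. 1 / (t\<^sup>2 + v\<^sup>2)) (pi / v)"
proof -
  have *: "integrable lborel (\<lambda>x::real. inverse (1 + x\<^sup>2))"
    using integrable_inverse_1_plus_square by (simp add: set_integrable_def)
  moreover have "(\<integral>x. inverse (1 + x\<^sup>2) \<partial>lborel) = pi"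
    using LBINT_inverse_1_plus_square
    by (simp add: interval_lebesgue_integral_def set_lebesgue_integral_def)
  ultimately have "has_bochner_integral lborel (\<lambda>x::real. inverse (1 + x\<^sup>2)) pi"
    using has_bochner_integral_iff by blast
  then have "has_bochner_integral lborel (\<lambda>x::real. inverse (1 + (0 + 1 / v * x)\<^sup>2)) (pi /\<^sub>R \<bar>1 / v\<bar>)"
    by (subst lborel_has_bochner_integral_real_affine_iff[where c="v" and t=0])
       (use assms in \<open>auto simp: has_bochner_integral_iff\<close>)
  then have "has_bochner_integral lborel (\<lambda>x::real. inverse (1 + (x / v)\<^sup>2) * (1 / v\<^sup>2)) ((pi * v) * (1 / v\<^sup>2))"
    using assms by (intro has_bochner_integral_mult_left) (auto simp: mult.commute)
  moreover have "inverse (1 + (x / v)\<^sup>2) * (1 / v\<^sup>2) = 1 / (x\<^sup>2 + v\<^sup>2)" for x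
    using assms by (simp add: power_divide field_simps)
  ultimately show ?thesis using assms by (simp add: power2_eq_square)
qed

text \<open>The class shared by the exponentials \<open>exp (\<i> * z * x)\<close> with
  \<open>x \<ge> 0\<close>, the constant 1 and the extension of the stable characteristic function.
  It is stable under holomorphic factors of modulus at most 1, continuous up to the boundary.
  Holomorphy is asked only in the open half plane since the stable function has a branch point at
  0.\<close>

locale bounded_halfplane_function =
  fixes F :: "complex \<Rightarrow> complex" and B :: real
  assumes continuous: "continuous_on {z. 0 \<le> Im z} F"
    and holomorphic: "F holomorphic_on {z. 0 < Im z}"
    and bounded: "\<And>z. 0 \<le> Im z \<Longrightarrow> norm (F z) \<le> B"
begin

lemma borel_measurable_on_reals [measurable]: "(\<lambda>t. F (of_real t)) \<in> borel_measurable borel"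
  by (intro borel_measurable_continuous_onI continuous_on_compose2[OF continuous])
     (auto intro!: continuous_intros)

lemma integrable_mult_on_reals:
  fixes k :: "real \<Rightarrow> complex"
  assumes "integrable lborel k"
  shows "integrable lborel (\<lambda>t. F (of_real t) * k t)"
proof (rule Bochner_Integration.integrable_bound)
  show "integrable lborel (\<lambda>t. of_real B * k t)" using assms by auto
  show "(\<lambda>t. F (of_real t) * k t) \<in> borel_measurable lborel"
    using assms by (intro borel_measurable_times) auto
  show "AE t in lborel. norm (F (of_real t) * k t) \<le> norm (of_real B * k t)"
    by (intro AE_I2) (auto simp: norm_mult intro!: mult_right_mono order_trans[OF bounded])
qed

lemma integrable_Cauchy_kernel:
  "v > 0 \<Longrightarrow> integrable lborel (\<lambda>t. F (of_real t) / (of_real (t\<^sup>2 + v\<^sup>2)))"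
  using integrable_mult_on_reals[OF integrable_of_real, of "\<lambda>t. 1 / (t\<^sup>2 + v\<^sup>2)"]
    has_bochner_integral_Cauchy_kernel[of v]
  by (simp add: has_bochner_integral_iff)

text \<open>Subtracting the value at \<open>\<i> v\<close> removes the pole, so that Cauchy's theorem on half discs
  applies to the difference quotient, which decays like \<open>1 / z\<^sup>2\<close>.\<close>
lemma Poisson_formula:
  assumes v: "v > 0"
  shows "(\<integral>t. F (of_real t) / of_real (t\<^sup>2 + v\<^sup>2) \<partial>lborel) = of_real (pi / v) * F (\<i> * of_real v)"
proof -
  define a where "a = \<i> * of_real v"
  define D where "D = (\<lambda>z. if z = a then deriv F a else (F z - F a) / (z - a))"
  \<comment> \<open>With \<open>a = \<i> * v\<close>, \<open>(z - a) * (z + a)\<close> is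
    \<open>z\<^sup>2 + v\<^sup>2\<close>; the remaining pole \<open>- a\<close> of \<open>G\<close>
    lies in the lower half plane.\<close>
  define G where "G = (\<lambda>z. D z / (z + a))"
  have opn: "open {z. 0 < Im z}" by (simp add: open_halfspace_Im_gt)
  have a: "a \<in> {z. 0 < Im z}" using v by (simp add: a_def)
  have Dhol: "D holomorphic_on {z. 0 < Im z}"
    unfolding D_def using a by (intro pole_lemma[OF holomorphic]) (simp only: interior_open[OF opn])
  have za: "z + a \<noteq> 0" if "0 \<le> Im z" for z
    using that v by (auto simp: a_def complex_eq_iff)
  have Dcont: "continuous_on {z. 0 \<le> Im z} D"
  proof (subst continuous_on_eq_continuous_within, safe)
    fix z assume z: "0 \<le> Im z"
    show "continuous (at z within {z. 0 \<le> Im z}) D"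
    proof (cases "z = a")
      case True
      then have "isCont D z"
        using Dhol a opn holomorphic_on_imp_continuous_on continuous_on_eq_continuous_at by blast
      then show ?thesis using continuous_at_imp_continuous_at_within by blast
    next
      case False
      have "continuous (at z within {z. 0 \<le> Im z}) (\<lambda>z. (F z - F a) / (z - a))"
        using False z continuous by (intro continuous_intros) (auto simp: continuous_on_eq_continuous_within)
      moreover have "\<forall>\<^sub>F w in at z within {z. 0 \<le> Im z}. (F w - F a) / (w - a) = D w"
        using eventually_neq_at_within[of a z "{z. 0 \<le> Im z}"]
        by (rule eventually_mono) (auto simp: D_def)
      moreover have "(F z - F a) / (z - a) = D z" using False by (simp add: D_def)
      ultimately show ?thesis
        unfolding continuous_within by (simp add: Lim_transform_eventually)
    qed
  qed
  have Gcont: "continuous_on {z. 0 \<le> Im z} G"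
    unfolding G_def using za by (intro continuous_intros Dcont) auto
  have Ghol: "G holomorphic_on {z. 0 < Im z}"
    unfolding G_def using za by (intro holomorphic_intros Dhol) auto
  have Geq: "G z = (F z - F a) / (z\<^sup>2 + of_real (v\<^sup>2))" if "z \<noteq> a" for z
    using that by (simp add: G_def D_def a_def power2_eq_square algebra_simps)
  have Greal: "G (of_real t) = F (of_real t) / of_real (t\<^sup>2 + v\<^sup>2) - F a * of_real (1 / (t\<^sup>2 + v\<^sup>2))" for t
    using v by (subst Geq) (auto simp: a_def complex_eq_iff diff_divide_distrib)
  have hb: "has_bochner_integral lborel (\<lambda>t. F a * of_real (1 / (t\<^sup>2 + v\<^sup>2))) (F a * of_real (pi / v))"
    using has_bochner_integral_Cauchy_kernel[OF v]
    by (intro has_bochner_integral_mult_right has_bochner_integral_of_real)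
  have Gint: "integrable lborel (\<lambda>t. G (of_real t))"
    unfolding Greal using hb integrable_Cauchy_kernel[OF v]
    by (auto simp: has_bochner_integral_iff)
  have B0: "B \<ge> 0" using bounded[of 0] norm_ge_zero[of "F 0"] by (simp del: norm_ge_zero)
  \<comment> \<open>The integral over the segment is minus the one over the arc: a bound
    \<open>2 * B / (R\<^sup>2 - v\<^sup>2)\<close> times the arc length \<open>R * pi\<close>, which
    vanishes as \<open>R\<close> grows.\<close>
  have half: "norm (integral {-R..R} (\<lambda>t. G (of_real t))) \<le> 2 * B / (R\<^sup>2 - v\<^sup>2) * R * pi"
    if R: "R > v" for R
  proof -
    let ?l = "linepath (of_real (-R)) (of_real R)" and ?c = "part_circlepath 0 R 0 pi"
    have R0: "R > 0" "R\<^sup>2 > v\<^sup>2" using R v by (auto intro: power_strict_mono)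
    have cv: "convex {z. 0 \<le> Im z}" by (simp add: convex_halfspace_Im_ge)
    have imc: "path_image ?c \<subseteq> {z. 0 \<le> Im z}"
      using R0 by (auto simp: path_image_part_circlepath Im_exp sin_ge_zero)
    have iml: "path_image ?l \<subseteq> {z. 0 \<le> Im z}"
      using cv by (auto simp: closed_segment_subset)
    \<comment> \<open>The segment runs along the boundary, where \<open>G\<close> is merely
      continuous; this form of Cauchy's theorem asks for differentiability in the interior
      only.\<close>
    have "(G has_contour_integral 0) (?l +++ ?c)"
    proof (rule Cauchy_theorem_convex[OF Gcont cv, where K="{}"])
      show "G field_differentiable at x" if "x \<in> interior {z. 0 \<le> Im z} - {}" for x
        using that Ghol opn interior_halfspace_ge[of \<i> 0]
        by (auto simp: holomorphic_on_open field_differentiable_def inner_complex_def)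
    qed (use imc iml in \<open>auto simp: path_image_join intro!: valid_path_join\<close>)
    moreover have ci: "G contour_integrable_on ?c" "G contour_integrable_on ?l"
      using Gcont imc iml
      by (auto intro!: contour_integrable_continuous_part_circlepath contour_integrable_continuous_linepath
           intro: continuous_on_subset simp flip: path_image_linepath)
    ultimately have "contour_integral ?l G + contour_integral ?c G = 0"
      by (metis contour_integral_join contour_integral_unique pathfinish_linepath pathstart_part_circlepath valid_path_linepath valid_path_part_circlepath)
    moreover have "contour_integral ?l G = integral {-R..R} (\<lambda>t. G (of_real t))"
      using R0 by (subst contour_integral_linepath_Reals_eq) auto
    moreover have "norm (contour_integral ?c G) \<le> 2 * B / (R\<^sup>2 - v\<^sup>2) * R * \<bar>pi - 0\<bar>"
    proof (rule contour_integral_bound_part_circlepath)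
      fix z assume z: "z \<in> path_image ?c"
      then have nz: "norm z = R" and Im: "0 \<le> Im z"
        using R0 imc by (auto simp: path_image_part_circlepath norm_mult)
      have "z \<noteq> a" using nz R v by (auto simp: a_def norm_mult)
      moreover have "norm (F z - F a) \<le> 2 * B"
        using norm_triangle_ineq4[of "F z" "F a"] bounded[OF Im] bounded[of a] a by auto
      moreover have "R\<^sup>2 - v\<^sup>2 \<le> norm (z\<^sup>2 + of_real (v\<^sup>2))"
        using norm_diff_ineq[of "z\<^sup>2" "of_real (v\<^sup>2)"] nz by (auto simp: norm_power norm_mult)
      ultimately show "norm (G z) \<le> 2 * B / (R\<^sup>2 - v\<^sup>2)"
        using R0 B0 by (auto simp: Geq norm_divide intro!: frac_le)
    qed (use ci R0 B0 in auto)
    ultimately show ?thesis by (metis abs_of_pos add_eq_0_iff diff_zero norm_minus_cancel pi_gt_zero)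
  qed
  have "((\<lambda>R. integral {-R..R} (\<lambda>t. G (of_real t))) \<longlongrightarrow> 0) at_top"
  proof (rule Lim_null_comparison)
    show "\<forall>\<^sub>F R in at_top. norm (integral {-R..R} (\<lambda>t. G (of_real t))) \<le> 2 * B / (R\<^sup>2 - v\<^sup>2) * R * pi"
      using eventually_gt_at_top[of v] by eventually_elim (rule half)
    show "((\<lambda>R. 2 * B / (R\<^sup>2 - v\<^sup>2) * R * pi) \<longlongrightarrow> 0) at_top"
      by real_asymp
  qed
  moreover have "((\<lambda>R. integral {-R..R} (\<lambda>t. G (of_real t))) \<longlongrightarrow> (\<integral>t. G (of_real t) \<partial>lborel)) at_top"
  proof -
    have "((\<lambda>R. \<integral>t. indicator {-R..R} t *\<^sub>R G (of_real t) \<partial>lborel) \<longlongrightarrow> (\<integral>t. G (of_real t) \<partial>lborel)) at_top"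
    proof (rule integral_dominated_convergence_at_top)
      show "integrable lborel (\<lambda>t. norm (G (of_real t)))" using Gint by auto
      show "\<forall>\<^sub>F R in at_top. AE t in lborel. norm (indicator {-R..R} t *\<^sub>R G (of_real t)) \<le> norm (G (of_real t))"
        by (auto simp: indicator_def)
      show "AE t in lborel. ((\<lambda>R. indicator {-R..R} t *\<^sub>R G (of_real t)) \<longlongrightarrow> G (of_real t)) at_top"
      proof (intro AE_I2)
        fix t :: real
        show "((\<lambda>R. indicator {-R..R} t *\<^sub>R G (of_real t)) \<longlongrightarrow> G (of_real t)) at_top"
          by (rule tendsto_eventually, rule eventually_mono[OF eventually_ge_at_top[of "\<bar>t\<bar>"]])
             (auto simp: indicator_def)
      qed
    qed (use Gint in auto)
    moreover have "(\<integral>t. indicator {-R..R} t *\<^sub>R G (of_real t) \<partial>lborel) = integral {-R..R} (\<lambda>t. G (of_real t))" for R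
      using Gint integrable_mult_indicator[of "{-R..R}" lborel "\<lambda>t. G (of_real t)"]
      by (subst set_borel_integral_eq_integral(2)[symmetric])
         (auto simp: set_lebesgue_integral_def set_integrable_def)
    ultimately show ?thesis by simp
  qed
  ultimately have "(\<integral>t. G (of_real t) \<partial>lborel) = 0"
    using tendsto_unique trivial_limit_at_top_linorder by blast
  then show ?thesis
    unfolding Greal using hb integrable_Cauchy_kernel[OF v]
    by (subst (asm) Bochner_Integration.integral_diff)
       (auto simp: has_bochner_integral_iff a_def mult.commute)
qed

end

section \<open>Characteristic functions extending to the half plane\<close>

text \<open>The modulus is \<open>exp (- x * Im z)\<close>, hence the sign of \<open>x\<close>.
  Negative \<open>x\<close> are later reached by reflecting \<open>t\<close>.\<close>

lemma bounded_halfplane_function_iexp: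
  assumes "x \<ge> 0"
  shows "bounded_halfplane_function (\<lambda>z. exp (\<i> * z * of_real x)) 1"
proof
  show "norm (exp (\<i> * z * of_real x)) \<le> 1" if "0 \<le> Im z" for z
    using that assms by (simp add: mult_nonneg_nonneg)
qed (auto intro!: continuous_intros holomorphic_intros)

lemma lborel_integral_reflect:
  fixes f :: "real \<Rightarrow> complex"
  shows "(\<integral>t. f t \<partial>lborel) = (\<integral>t. f (- t) \<partial>lborel)"
  using lborel_integral_real_affine[of "- 1" f 0] by simp

lemma Fourier_Cauchy_kernel:
  fixes v x :: real
  assumes v: "v > 0"
  shows "(\<integral>t. iexp (t * x) / of_real (t\<^sup>2 + v\<^sup>2) \<partial>lborel) = of_real (pi / v * exp (- v * \<bar>x\<bar>))"
proof -
  have *: "(\<integral>t. iexp (t * x) / of_real (t\<^sup>2 + v\<^sup>2) \<partial>lborel) = of_real (pi / v * exp (- v * x))" if "x \<ge> 0" for x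
  proof -
    interpret E: bounded_halfplane_function "\<lambda>z. exp (\<i> * z * of_real x)" 1
      using that by (rule bounded_halfplane_function_iexp)
    have "\<i> * (\<i> * of_real v) * of_real x = of_real (- v * x)" by simp
    then have "exp (\<i> * (\<i> * of_real v) * of_real x) = of_real (exp (- v * x))"
      by (simp only: exp_of_real)
    then show ?thesis
      using E.Poisson_formula[OF v] by (simp only: of_real_mult mult.assoc)
  qed
  show ?thesis
  proof (cases "x \<ge> 0")
    case True
    then show ?thesis using *[of x] by simp
  next
    case False
    have "(\<integral>t. iexp (t * x) / of_real (t\<^sup>2 + v\<^sup>2) \<partial>lborel) = (\<integral>t. iexp (- t * x) / of_real ((- t)\<^sup>2 + v\<^sup>2) \<partial>lborel)"
      by (rule lborel_integral_reflect)
    also have "\<dots> = (\<integral>t. iexp (t * (- x)) / of_real (t\<^sup>2 + v\<^sup>2) \<partial>lborel)" by simp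
    also have "\<dots> = of_real (pi / v * exp (- v * (- x)))" using False by (intro *) simp
    finally show ?thesis using False by simp
  qed
qed

lemma nonzero_kernel_factors [simp]:
  "complex_of_real t + \<i> \<noteq> 0" "complex_of_real t + 2 * \<i> \<noteq> 0"
  "complex_of_real t \<noteq> \<i>" "complex_of_real t \<noteq> 2 * \<i>"
  by (auto simp: complex_eq_iff)

text \<open>Apply the Poisson formula at \<open>\<i>\<close> to
  \<open>F z * ((z - \<i>) / (z + 2 * \<i>))\<close>. The extra factor has modulus at most 1 in the
  half plane, vanishes at \<open>\<i>\<close>, and cancels the upper pole of
  \<open>1 / (t\<^sup>2 + 1)\<close>.\<close>

lemma (in bounded_halfplane_function) lower_poles_kernel:
  "integrable lborel (\<lambda>t. F (of_real t) / ((of_real t + \<i>) * (of_real t + 2 * \<i>)))"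
  "(\<integral>t. F (of_real t) / ((of_real t + \<i>) * (of_real t + 2 * \<i>)) \<partial>lborel) = 0"
proof -
  have nz: "z + 2 * \<i> \<noteq> 0" if "0 \<le> Im z" for z using that by (auto simp: complex_eq_iff)
  interpret G: bounded_halfplane_function "\<lambda>z. F z * ((z - \<i>) / (z + 2 * \<i>))" B
  proof
    show "continuous_on {z. 0 \<le> Im z} (\<lambda>z. F z * ((z - \<i>) / (z + 2 * \<i>)))"
      using nz by (intro continuous_intros continuous) auto
    show "(\<lambda>z. F z * ((z - \<i>) / (z + 2 * \<i>))) holomorphic_on {z. 0 < Im z}"
      using nz by (intro holomorphic_intros holomorphic) auto
    fix z assume z: "0 \<le> Im z"
    have "norm (z - \<i>) \<le> norm (z + 2 * \<i>)"
      using z by (simp add: cmod_def power2_eq_square algebra_simps)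
    then have "norm ((z - \<i>) / (z + 2 * \<i>)) \<le> 1"
      using nz[OF z] by (simp add: norm_divide)
    then show "norm (F z * ((z - \<i>) / (z + 2 * \<i>))) \<le> B"
      using bounded[OF z] mult_mono[of "norm (F z)" B "norm ((z - \<i>) / (z + 2 * \<i>))" 1]
        order_trans[OF norm_ge_zero bounded[OF z]]
      unfolding norm_mult by simp
  qed
  have eq: "F (of_real t) * ((of_real t - \<i>) / (of_real t + 2 * \<i>)) / of_real (t\<^sup>2 + 1\<^sup>2) =
     F (of_real t) / ((of_real t + \<i>) * (of_real t + 2 * \<i>))" for t :: real
  proof -
    have "complex_of_real (t\<^sup>2 + 1\<^sup>2) = (of_real t - \<i>) * (of_real t + \<i>)"
      by (simp add: power2_eq_square algebra_simps)
    then show ?thesis by (simp only:) (simp add: divide_simps)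
  qed
  show "integrable lborel (\<lambda>t. F (of_real t) / ((of_real t + \<i>) * (of_real t + 2 * \<i>)))"
    using G.integrable_Cauchy_kernel[of 1] unfolding eq by simp
  show "(\<integral>t. F (of_real t) / ((of_real t + \<i>) * (of_real t + 2 * \<i>)) \<partial>lborel) = 0"
    using G.Poisson_formula[of 1] unfolding eq by simp
qed

text \<open>For \<open>x < 0\<close>, reflection moves the poles into the upper half plane, where
  partial fractions express the kernel through Cauchy kernels with \<open>v = 1, 2\<close> and the
  lower-pole kernel. The value there is strictly negative, which is what makes this kernel detect
  negative mass.\<close>

lemma Fourier_lower_poles_kernel:
  fixes x :: real
  shows "(\<integral>t. iexp (t * x) / ((of_real t + \<i>) * (of_real t + 2 * \<i>)) \<partial>lborel) =
    (if x \<ge> 0 then 0 else of_real (2 * pi * (exp (2 * x) - exp x)))"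
proof (cases "x \<ge> 0")
  case True
  interpret E: bounded_halfplane_function "\<lambda>z. exp (\<i> * z * of_real x)" 1
    using True by (rule bounded_halfplane_function_iexp)
  show ?thesis using E.lower_poles_kernel(2) True by (simp add: mult.assoc)
next
  case False
  define y where "y = - x"
  have y: "y > 0" using False by (simp add: y_def)
  interpret E: bounded_halfplane_function "\<lambda>z. exp (\<i> * z * of_real y)" 1
    using y by (intro bounded_halfplane_function_iexp) simp
  let ?e = "\<lambda>t. exp (\<i> * of_real t * of_real y)"
  \<comment> \<open>On the real line the reflected kernel is the complex conjugate of the original;
    their sum \<open>2 * (t\<^sup>2 - 2) / ((t\<^sup>2 + 1) * (t\<^sup>2 + 4))\<close> splits with
    coefficients 4 and -2.\<close>
  have pf: "e / ((- of_real t + \<i>) * (- of_real t + 2 * \<i>)) =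
     4 * (e / of_real (t\<^sup>2 + 2\<^sup>2)) - 2 * (e / of_real (t\<^sup>2 + 1\<^sup>2)) - e / ((of_real t + \<i>) * (of_real t + 2 * \<i>))" for e and t :: real
  proof -
    have 1: "complex_of_real (t\<^sup>2 + 1\<^sup>2) = (of_real t - \<i>) * (of_real t + \<i>)"
      and 2: "complex_of_real (t\<^sup>2 + 2\<^sup>2) = (of_real t - 2 * \<i>) * (of_real t + 2 * \<i>)"
      by (simp_all add: power2_eq_square algebra_simps)
    have 3: "(- of_real t + \<i>) * (- of_real t + 2 * \<i>) = (of_real t - \<i>) * (of_real t - 2 * \<i> :: complex)"
      by (simp add: algebra_simps)
    show ?thesis unfolding 1 2 3 by (simp add: divide_simps) (simp add: algebra_simps)
  qed
  have "(\<integral>t. iexp (t * x) / ((of_real t + \<i>) * (of_real t + 2 * \<i>)) \<partial>lborel) =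
     (\<integral>t. iexp (- t * x) / ((of_real (- t) + \<i>) * (of_real (- t) + 2 * \<i>)) \<partial>lborel)"
    by (rule lborel_integral_reflect)
  also have "\<dots> = (\<integral>t. 4 * (?e t / of_real (t\<^sup>2 + 2\<^sup>2)) - 2 * (?e t / of_real (t\<^sup>2 + 1\<^sup>2)) - ?e t / ((of_real t + \<i>) * (of_real t + 2 * \<i>)) \<partial>lborel)"
    by (intro Bochner_Integration.integral_cong refl, subst pf[symmetric]) (simp add: y_def mult.assoc)
  also have "\<dots> = 4 * (\<integral>t. ?e t / of_real (t\<^sup>2 + 2\<^sup>2) \<partial>lborel) - 2 * (\<integral>t. ?e t / of_real (t\<^sup>2 + 1\<^sup>2) \<partial>lborel) -
     (\<integral>t. ?e t / ((of_real t + \<i>) * (of_real t + 2 * \<i>)) \<partial>lborel)"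
    using E.integrable_Cauchy_kernel[of 1] E.integrable_Cauchy_kernel[of 2] E.lower_poles_kernel(1)
    unfolding integral_mult_right_zero[symmetric]
    by (simp only: Bochner_Integration.integral_diff Bochner_Integration.integrable_diff integrable_mult_right)
  also have "\<dots> = of_real (2 * pi * (exp (2 * x) - exp x))"
    using Fourier_Cauchy_kernel[of 1 y] Fourier_Cauchy_kernel[of 2 y] E.lower_poles_kernel(2) y
    by (simp add: y_def mult.assoc algebra_simps)
  finally show ?thesis using False by simp
qed

text \<open>Fubini, as \<open>iexp\<close> has modulus 1. Information about \<open>M\<close> is then
  read off by choosing kernels \<open>k\<close> whose Fourier transform is explicit.\<close>

lemma (in real_distribution) integral_char_eq:
  fixes k :: "real \<Rightarrow> complex"
  assumes k: "integrable lborel k"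
  shows "(\<integral>t. k t * char M t \<partial>lborel) = (\<integral>x. (\<integral>t. k t * iexp (t * x) \<partial>lborel) \<partial>M)"
proof -
  interpret P: pair_sigma_finite M lborel ..
  have [measurable]: "k \<in> borel_measurable borel" using k by auto
  have 1: "integrable (M \<Otimes>\<^sub>M lborel) (\<lambda>(x, t). k t * iexp (t * x))"
  proof (rule P.Fubini_integrable)
    show "AE x in M. integrable lborel (\<lambda>t. case (x, t) of (x, t) \<Rightarrow> k t * iexp (t * x))"
      using integrable_norm[OF k] by (auto intro!: Bochner_Integration.integrable_bound[OF k] simp: norm_mult)
  qed (auto simp: norm_mult split_beta')
  have "(\<integral>t. k t * char M t \<partial>lborel) = (\<integral>t. (\<integral>x. k t * iexp (t * x) \<partial>M) \<partial>lborel)"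
    unfolding char_def by simp
  also have "\<dots> = (\<integral>x. (\<integral>t. k t * iexp (t * x) \<partial>lborel) \<partial>M)"
    using P.Fubini_integral[OF 1] .
  finally show ?thesis .
qed

text \<open>The kernel with both poles in the lower half plane detects the negative half line.\<close>
lemma (in real_distribution) AE_nonneg_of_halfplane_char:
  assumes "bounded_halfplane_function F B" and char: "\<And>t. char M t = F (of_real t)"
  shows "AE x in M. 0 \<le> x"
proof -
  interpret F: bounded_halfplane_function F B by fact
  interpret one: bounded_halfplane_function "\<lambda>_. 1" 1 by standard auto
  let ?k = "\<lambda>t. 1 / ((complex_of_real t + \<i>) * (of_real t + 2 * \<i>))"
  \<comment> \<open>\<open>h\<close> is minus the Fourier transform of \<open>?k\<close>:
    nonnegative, with zero set exactly the nonnegative half line. A vanishing mean of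
    \<open>h\<close> thus forces \<open>x \<ge> 0\<close> almost surely.\<close>
  define h :: "real \<Rightarrow> real" where "h = (\<lambda>x. if x \<ge> 0 then 0 else 2 * pi * (exp x - exp (2 * x)))"
  have [measurable]: "h \<in> borel_measurable borel" unfolding h_def by measurable
  have nn: "0 \<le> h x" for x by (simp add: h_def)
  have "integrable M h"
  proof (rule integrable_const_bound[of _ "2 * pi"])
    have "\<bar>h x\<bar> \<le> 2 * pi" for x
    proof (cases "x \<ge> 0")
      case False
      then have "exp x - exp (2 * x) \<le> 1 - 0" by (intro diff_mono) auto
      then have "2 * pi * (exp x - exp (2 * x)) \<le> 2 * pi * 1" by (intro mult_left_mono) auto
      then show ?thesis using False by (simp add: h_def)
    qed (simp add: h_def)
    then show "AE x in M. norm (h x) \<le> 2 * pi" by simp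
  qed auto
  have "0 = (\<integral>t. ?k t * char M t \<partial>lborel)"
    using F.lower_poles_kernel(2) by (simp add: char)
  also have "\<dots> = (\<integral>x. (\<integral>t. ?k t * iexp (t * x) \<partial>lborel) \<partial>M)"
    using one.lower_poles_kernel(1) by (intro integral_char_eq)
  also have "\<dots> = (\<integral>x. - complex_of_real (h x) \<partial>M)"
    using Fourier_lower_poles_kernel
    by (intro Bochner_Integration.integral_cong) (auto simp: h_def algebra_simps)
  also have "\<dots> = - complex_of_real (\<integral>x. h x \<partial>M)"
    by (subst integral_minus, subst integral_complex_of_real) simp
  finally have "(\<integral>x. h x \<partial>M) = 0" by (metis neg_equal_0_iff_equal of_real_eq_0_iff)
  then have "AE x in M. h x = 0"
    using integral_nonneg_eq_0_iff_AE[OF \<open>integrable M h\<close>] nn by auto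
  then show ?thesis
  proof eventually_elim
    fix x assume "h x = 0"
    then show "0 \<le> x" by (cases "x \<ge> 0") (auto simp: h_def)
  qed
qed

text \<open>The integral of \<open>char M\<close> against the Cauchy kernel is evaluated twice: by
  the Poisson formula for \<open>F\<close>, and by Fubini, which produces
  \<open>exp (- v * \<bar>x\<bar>)\<close>. Almost sure nonnegativity removes the absolute
  value.\<close>

lemma (in real_distribution) Laplace_of_halfplane_char:
  assumes "bounded_halfplane_function F B" and char: "\<And>t. char M t = F (of_real t)" and v: "v > 0"
  shows "of_real (\<integral>x. exp (- v * x) \<partial>M) = F (\<i> * of_real v)"
proof -
  interpret F: bounded_halfplane_function F B by fact
  interpret one: bounded_halfplane_function "\<lambda>_. 1" 1 by standard auto
  let ?k = "\<lambda>t. 1 / complex_of_real (t\<^sup>2 + v\<^sup>2)"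
  have "of_real (pi / v) * F (\<i> * of_real v) = (\<integral>t. ?k t * char M t \<partial>lborel)"
    using F.Poisson_formula[OF v] by (simp add: char)
  also have "\<dots> = (\<integral>x. (\<integral>t. ?k t * iexp (t * x) \<partial>lborel) \<partial>M)"
    using one.integrable_Cauchy_kernel[OF v] by (intro integral_char_eq)
  also have "\<dots> = (\<integral>x. of_real (pi / v * exp (- v * \<bar>x\<bar>)) \<partial>M)"
    using Fourier_Cauchy_kernel[OF v] by (intro Bochner_Integration.integral_cong) auto
  also have "\<dots> = of_real (pi / v * (\<integral>x. exp (- v * \<bar>x\<bar>) \<partial>M))"
    by (subst integral_complex_of_real) simp
  finally have "F (\<i> * of_real v) = of_real (\<integral>x. exp (- v * \<bar>x\<bar>) \<partial>M)"
    using v by simp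
  moreover have "(\<integral>x. exp (- v * \<bar>x\<bar>) \<partial>M) = (\<integral>x. exp (- v * x) \<partial>M)"
  proof (rule integral_cong_AE)
    show "AE x in M. exp (- v * \<bar>x\<bar>) = exp (- v * x)"
      using AE_nonneg_of_halfplane_char[OF assms(1,2)] by eventually_elim simp
  qed auto
  ultimately show ?thesis by simp
qed

section \<open>One-sided stable laws\<close>

lemma bounded_halfplane_function_stable:
  assumes \<alpha>: "0 < \<alpha>" "\<alpha> < 1"
  shows "bounded_halfplane_function (\<lambda>z. exp (- ((- \<i> * z) powr of_real \<alpha>))) 1"
proof
  show "continuous_on {z. 0 \<le> Im z} (\<lambda>z. exp (- ((- \<i> * z) powr of_real \<alpha>)))"
    using \<alpha> by (intro continuous_intros) auto
  show "(\<lambda>z. exp (- ((- \<i> * z) powr of_real \<alpha>))) holomorphic_on {z. 0 < Im z}"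
    by (intro holomorphic_intros) (auto simp: complex_nonpos_Reals_iff)
  fix z assume z: "0 \<le> Im z"
  show "norm (exp (- ((- \<i> * z) powr of_real \<alpha>))) \<le> 1"
  proof (cases "z = 0")
    case False
    \<comment> \<open>The rotation maps the upper half plane to the right half plane, where
      arguments are at most \<open>pi / 2\<close> in modulus. Since \<open>\<alpha> < 1\<close>, the
      power stays there, and \<open>exp\<close> of its negative has modulus at most 1.\<close>
    define w where "w = - \<i> * z"
    have w: "w \<noteq> 0" "0 \<le> Re w" using False z by (auto simp: w_def)
    then have "\<bar>Im (Ln w)\<bar> \<le> pi / 2" using Re_Ln_pos_le by blast
    then have "\<bar>\<alpha> * Im (Ln w)\<bar> \<le> 1 * (pi / 2)"
      using \<alpha> unfolding abs_mult by (intro mult_mono) auto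
    then have "cos (\<alpha> * Im (Ln w)) \<ge> 0" by (intro cos_ge_zero) auto
    then have "Re (w powr of_real \<alpha>) \<ge> 0" using w by (simp add: powr_def Re_exp)
    then show ?thesis by (simp add: w_def)
  qed simp
qed

text \<open>On the principal branch, \<open>- \<i> * t\<close> has argument \<open>- pi / 2\<close>
  for positive and \<open>pi / 2\<close> for negative \<open>t\<close>, which reproduces the sign in
  the exponent. At \<open>t = 0\<close> both sides are 0.\<close>

lemma stable_exponent_eq:
  fixes t :: real
  shows "(- \<i> * of_real t) powr of_real \<alpha> =
    complex_of_real (\<bar>t\<bar> powr \<alpha>) * exp (- \<i> * of_real (pi * \<alpha> * sgn t / 2))"
proof (cases "t = 0")
  case False
  have Ln_eq: "Ln (- \<i> * of_real t) = of_real (ln \<bar>t\<bar>) - \<i> * of_real (pi * sgn t / 2)"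
  proof (cases "t > 0")
    case True
    have "Ln (of_real t * (- \<i>)) = of_real (ln t) + Ln (- \<i>)"
      using True by (subst Ln_times_of_real) (auto simp: Ln_of_real)
    then show ?thesis using True by (simp add: mult.commute)
  next
    case F: False
    have "Ln (of_real (- t) * \<i>) = of_real (ln (- t)) + Ln \<i>"
      using F False by (subst Ln_times_of_real) (auto simp: Ln_of_real simp flip: of_real_minus)
    then show ?thesis using F False by (simp add: mult.commute)
  qed
  have "(- \<i> * of_real t) powr of_real \<alpha> =
      exp (of_real (\<alpha> * ln \<bar>t\<bar>)) * exp (- \<i> * of_real (pi * \<alpha> * sgn t / 2))"
    using False unfolding exp_add[symmetric] powr_def Ln_eq by (simp add: algebra_simps)
  then show ?thesis using False unfolding exp_of_real by (simp add: powr_def)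
qed simp

lemma (in real_distribution) stable_char_Laplace:
  assumes \<alpha>: "0 < \<alpha>" "\<alpha> < 1"
    and char: "\<And>t. char M t = exp (- (complex_of_real (\<bar>t\<bar> powr \<alpha>))
                      * exp (- \<i> * complex_of_real (pi * \<alpha> * sgn t / 2)))"
  shows "AE x in M. 0 < x"
    and "s \<ge> 0 \<Longrightarrow> (\<integral>\<^sup>+x. ennreal (exp (- s * x)) \<partial>M) = ennreal (exp (- (s powr \<alpha>)))"
proof -
  let ?F = "\<lambda>z. exp (- ((- \<i> * z) powr of_real \<alpha>))"
  have F: "bounded_halfplane_function ?F 1" using \<alpha> by (rule bounded_halfplane_function_stable)
  have char': "char M t = ?F (of_real t)" for t
    unfolding char stable_exponent_eq by simp
  have nn: "AE x in M. 0 \<le> x" using AE_nonneg_of_halfplane_char[OF F char'] .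
  have L: "(\<integral>x. exp (- s * x) \<partial>M) = exp (- (s powr \<alpha>))" if "s > 0" for s
  proof -
    have "(- \<i> * (\<i> * of_real s)) powr of_real \<alpha> = complex_of_real (s powr \<alpha>)"
      using that by (simp add: powr_of_real)
    then have "?F (\<i> * of_real s) = complex_of_real (exp (- (s powr \<alpha>)))"
      by (metis exp_of_real of_real_minus)
    then show ?thesis using Laplace_of_halfplane_char[OF F char' that]
      by (metis of_real_eq_iff)
  qed
  have int: "integrable M (\<lambda>x. exp (- s * x))" if "s \<ge> 0" for s
  proof (rule integrable_const_bound[of _ 1])
    show "AE x in M. norm (exp (- s * x)) \<le> 1"
      using nn by eventually_elim (use that in \<open>simp add: mult_nonneg_nonneg\<close>)
  qed auto
  show "(\<integral>\<^sup>+x. ennreal (exp (- s * x)) \<partial>M) = ennreal (exp (- (s powr \<alpha>)))" if "s \<ge> 0"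
  proof (cases "s = 0")
    case True
    then show ?thesis using emeasure_space_1 by simp
  next
    case False
    then show ?thesis using that L[of s] int[OF that] by (subst nn_integral_eq_integral) auto
  qed
  \<comment> \<open>An atom at 0 would contribute its full mass to every Laplace transform value,
    but these tend to 0 as \<open>s\<close> grows.\<close>
  have "prob {0} \<le> exp (- (s powr \<alpha>))" if "s > 0" for s
  proof -
    have "prob {0} = (\<integral>x. indicator {0} x \<partial>M)" by simp
    also have "\<dots> \<le> (\<integral>x. exp (- s * x) \<partial>M)"
      using that int[of s] by (intro integral_mono_AE integrable_real_indicator) (auto simp: indicator_def less_top[symmetric])
    finally show ?thesis using L[OF that] by simp
  qed
  then have "\<forall>\<^sub>F s in at_top. prob {0} \<le> exp (- (s powr \<alpha>))"
    by (intro eventually_mono[OF eventually_gt_at_top[of 0]])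
  moreover have "((\<lambda>s. exp (- (s powr \<alpha>))) \<longlongrightarrow> 0) at_top" using \<alpha> by real_asymp
  ultimately have "prob {0} \<le> 0" by (intro tendsto_lowerbound[of _ 0 at_top]) auto
  then have "emeasure M {0} = 0" by (simp add: emeasure_eq_measure measure_le_0_iff)
  then have "AE x in M. x \<noteq> 0"
    by (intro AE_I[of _ _ "{0}"]) auto
  with nn show "AE x in M. 0 < x" by eventually_elim auto
qed

section \<open>Gamma integrals\<close>

lemma gamma_density_Laplace:
  assumes s: "s > 0" and a: "a \<ge> 0"
  shows "(\<integral>\<^sup>+x. ennreal (gamma_density s x) * ennreal (exp (- a * x)) \<partial>lborel) = ennreal ((1 + a) powr (- s))"
proof -
  \<comment> \<open>Rescaling the normalisation integral by \<open>1 + a\<close> merges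
    \<open>exp (- a * x)\<close> with the exponential factor of the density.\<close>
  have "1 = (\<integral>\<^sup>+x. ennreal (gamma_density s x) \<partial>lborel)"
    using nn_integral_gamma_density[OF s] by simp
  also have "\<dots> = ennreal \<bar>1 + a\<bar> * (\<integral>\<^sup>+x. ennreal (gamma_density s (0 + (1 + a) * x)) \<partial>lborel)"
    using a by (intro nn_integral_real_affine) auto
  finally have "ennreal ((1 + a) powr (- s)) =
    ennreal ((1 + a) powr (- s)) * (ennreal (1 + a) * (\<integral>\<^sup>+x. ennreal (gamma_density s ((1 + a) * x)) \<partial>lborel))"
    using a by simp
  also have "\<dots> = (\<integral>\<^sup>+x. ennreal ((1 + a) powr (- s)) * (ennreal (1 + a) * ennreal (gamma_density s ((1 + a) * x))) \<partial>lborel)"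
    by (simp add: nn_integral_cmult)
  also have "\<dots> = (\<integral>\<^sup>+x. ennreal (gamma_density s x) * ennreal (exp (- a * x)) \<partial>lborel)"
  proof (rule nn_integral_cong)
    fix x
    show "ennreal ((1 + a) powr (- s)) * (ennreal (1 + a) * ennreal (gamma_density s ((1 + a) * x))) =
      ennreal (gamma_density s x) * ennreal (exp (- a * x))"
    proof (cases "x > 0")
      case True
      have "(1 + a) powr (- s) * ((1 + a) powr 1 * (1 + a) powr (s - 1)) = 1"
        unfolding powr_add[symmetric] using a by simp
      then have "(1 + a) powr (- s) * ((1 + a) * ((1 + a) powr (s - 1) * x powr (s - 1))) = x powr (s - 1)"
        using a by (simp add: mult.assoc[symmetric])
      moreover have "exp (- ((1 + a) * x)) = exp (- x) * exp (- a * x)"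
        by (simp add: algebra_simps flip: exp_add)
      ultimately have "(1 + a) powr (- s) * ((1 + a) * gamma_density s ((1 + a) * x)) = gamma_density s x * exp (- a * x)"
        using True a by (simp add: gamma_density_def powr_mult)
      then show ?thesis using s a by (simp del: ennreal_plus flip: ennreal_mult')
    next
      case False
      then show ?thesis using a by (simp add: gamma_density_def zero_less_mult_iff)
    qed
  qed
  finally show ?thesis by simp
qed

text \<open>Shift the tail integral by \<open>y\<close>: the exponential gives
  \<open>exp (- y)\<close>, and \<open>(y + g) powr (r - 1)\<close> factors as
  \<open>g powr (r - 1)\<close> times a power of \<open>1 + y / g\<close>. The left side is what
  survives once \<open>W\<close>, \<open>S\<close> and \<open>G2\<close> are integrated out.\<close>

lemma gamma_density_tail_mixture:
  assumes r: "0 < r" and y: "y \<ge> 0"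
  shows "(\<integral>\<^sup>+g. ennreal (gamma_density r g) * ennreal (exp (- y) * (1 + y / g) powr (- (1 - r))) \<partial>lborel) =
    (\<integral>\<^sup>+u. ennreal (gamma_density r u) * indicator {y<..} u \<partial>lborel)"
proof -
  have "(\<integral>\<^sup>+u. ennreal (gamma_density r u) * indicator {y<..} u \<partial>lborel) =
    ennreal \<bar>1\<bar> * (\<integral>\<^sup>+g. ennreal (gamma_density r (y + 1 * g)) * indicator {y<..} (y + 1 * g) \<partial>lborel)"
    by (rule nn_integral_real_affine) auto
  also have "\<dots> = (\<integral>\<^sup>+g. ennreal (gamma_density r (y + g)) * indicator {y<..} (y + g) \<partial>lborel)" by simp
  also have "\<dots> = (\<integral>\<^sup>+g. ennreal (gamma_density r g) * ennreal (exp (- y) * (1 + y / g) powr (- (1 - r))) \<partial>lborel)"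
  proof (rule nn_integral_cong)
    fix g
    show "ennreal (gamma_density r (y + g)) * indicator {y<..} (y + g) =
      ennreal (gamma_density r g) * ennreal (exp (- y) * (1 + y / g) powr (- (1 - r)))"
    proof (cases "g > 0")
      case True
      then have "1 + y / g = (y + g) / g" by (simp add: field_simps)
      then have "g powr (r - 1) * (1 + y / g) powr (- (1 - r)) = (y + g) powr (r - 1)"
        using True y by (simp add: powr_divide)
      then have "gamma_density r (y + g) = gamma_density r g * (exp (- y) * (1 + y / g) powr (- (1 - r)))"
        using True y by (simp add: gamma_density_def exp_add exp_diff exp_minus field_simps)
      then show ?thesis using True r by (simp add: ennreal_mult')
    qed (auto simp: gamma_density_def)
  qed
  finally show ?thesis by simp
qed

section \<open>The mixed exponential representation\<close>

lemma borel_measurable_compose_4: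
  fixes h :: "real \<Rightarrow> real \<Rightarrow> real \<Rightarrow> real \<Rightarrow> ennreal"
  assumes h: "(\<lambda>(a, b, c, d). h a b c d) \<in> borel_measurable (borel \<Otimes>\<^sub>M borel \<Otimes>\<^sub>M borel \<Otimes>\<^sub>M borel)"
    and [measurable]: "f1 \<in> borel_measurable K" "f2 \<in> borel_measurable K" "f3 \<in> borel_measurable K" "f4 \<in> borel_measurable K"
  shows "(\<lambda>x. h (f1 x) (f2 x) (f3 x) (f4 x)) \<in> borel_measurable K"
  using measurable_compose[of "\<lambda>x. (f1 x, f2 x, f3 x, f4 x)" K, OF _ h] by simp

text \<open>The order of integration, with indices 0, 1, 3, 2 from the inside out, is chosen for
  \<open>W\<close>, \<open>S\<close>, \<open>G2\<close>, \<open>G1\<close>, so that each inner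
  integral has a closed form.\<close>

lemma (in prob_space) nn_integral_indep_vars_4:
  fixes X :: "nat \<Rightarrow> 'a \<Rightarrow> real" and h :: "real \<Rightarrow> real \<Rightarrow> real \<Rightarrow> real \<Rightarrow> ennreal"
  assumes indep: "indep_vars (\<lambda>_. borel) X {0, 1, 2, 3}"
    and h: "(\<lambda>(a, b, c, d). h a b c d) \<in> borel_measurable (borel \<Otimes>\<^sub>M borel \<Otimes>\<^sub>M borel \<Otimes>\<^sub>M borel)"
  shows "(\<integral>\<^sup>+\<omega>. h (X 0 \<omega>) (X 1 \<omega>) (X 2 \<omega>) (X 3 \<omega>) \<partial>M) =
    (\<integral>\<^sup>+c. \<integral>\<^sup>+d. \<integral>\<^sup>+b. \<integral>\<^sup>+a. h a b c d \<partial>distr M borel (X 0) \<partial>distr M borel (X 1) \<partial>distr M borel (X 3) \<partial>distr M borel (X 2))"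
proof -
  \<comment> \<open>\<open>Y\<close> continues the family to all indices, because
    \<open>product_sigma_finite\<close> asks for a sigma-finite measure at each of them.\<close>
  define Y where "Y i = (if i \<in> {0, 1, 2, 3} then X i else X 0)" for i
  have Ym [measurable]: "Y i \<in> borel_measurable M" for i
    using indep by (auto simp: indep_vars_def Y_def)
  have YX: "Y 0 = X 0" "Y 1 = X 1" "Y 2 = X 2" "Y 3 = X 3" by (auto simp: Y_def)
  have "indep_vars (\<lambda>_. borel) Y {0, 1, 2, 3}"
    using indep by (rule indep_vars_cong[THEN iffD1, rotated -1]) (auto simp: Y_def)
  then have D: "distr M (\<Pi>\<^sub>M i\<in>{0, 1, 2, 3}. borel) (\<lambda>\<omega>. \<lambda>i\<in>{0, 1, 2, 3}. Y i \<omega>) = (\<Pi>\<^sub>M i\<in>{0, 1, 2, 3}. distr M borel (Y i))"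
    by (subst (asm) indep_vars_iff_distr_eq_PiM) auto
  interpret P: prob_space "distr M borel (Y i)" for i by (rule prob_space_distr) simp
  interpret P: product_sigma_finite "\<lambda>i. distr M borel (Y i)" ..
  note hm [measurable (raw)] = borel_measurable_compose_4[OF h]
  let ?D = "\<lambda>i. distr M borel (Y i)"
  have I: "{0, 1, 2, 3} = insert 0 (insert 1 (insert 3 {2::nat}))" by auto
  have "(\<integral>\<^sup>+\<omega>. h (X 0 \<omega>) (X 1 \<omega>) (X 2 \<omega>) (X 3 \<omega>) \<partial>M) =
    (\<integral>\<^sup>+f. h (f 0) (f 1) (f 2) (f 3) \<partial>distr M (\<Pi>\<^sub>M i\<in>{0, 1, 2, 3}. borel) (\<lambda>\<omega>. \<lambda>i\<in>{0, 1, 2, 3}. Y i \<omega>))"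
    by (subst nn_integral_distr) (auto simp: YX simp del: One_nat_def)
  also have "\<dots> = (\<integral>\<^sup>+f. h (f 0) (f 1) (f 2) (f 3) \<partial>Pi\<^sub>M (insert 0 (insert 1 (insert 3 {2}))) ?D)"
    unfolding D unfolding I ..
  also have "\<dots> = (\<integral>\<^sup>+f. \<integral>\<^sup>+a. h a (f 1) (f 2) (f 3) \<partial>?D 0 \<partial>Pi\<^sub>M (insert 1 (insert 3 {2})) ?D)"
    by (subst P.product_nn_integral_insert) auto
  also have "\<dots> = (\<integral>\<^sup>+f. \<integral>\<^sup>+b. \<integral>\<^sup>+a. h a b (f 2) (f 3) \<partial>?D 0 \<partial>?D 1 \<partial>Pi\<^sub>M (insert 3 {2}) ?D)"
    by (subst P.product_nn_integral_insert) auto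
  also have "\<dots> = (\<integral>\<^sup>+f. \<integral>\<^sup>+d. \<integral>\<^sup>+b. \<integral>\<^sup>+a. h a b (f 2) d \<partial>?D 0 \<partial>?D 1 \<partial>?D 3 \<partial>Pi\<^sub>M {2} ?D)"
    by (subst P.product_nn_integral_insert) auto
  also have "\<dots> = (\<integral>\<^sup>+c. \<integral>\<^sup>+d. \<integral>\<^sup>+b. \<integral>\<^sup>+a. h a b c d \<partial>?D 0 \<partial>?D 1 \<partial>?D 3 \<partial>?D 2)"
    by (subst P.product_nn_integral_singleton) auto
  finally show ?thesis unfolding YX .
qed

lemma gg_mixed_exponential:
  fixes W S G1 G2 :: "'b \<Rightarrow> real"
  assumes "prob_space M"
    and r: "0 < r" "r < 1" and \<alpha>: "0 < \<alpha>" "\<alpha> < 1" and c: "0 < c"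
    and indep: "prob_space.indep_vars M (\<lambda>_. borel)
            (\<lambda>i::nat. if i = 0 then W else if i = 1 then S else if i = 2 then G1 else G2) {0, 1, 2, 3}"
    and W: "distributed M lborel W (\<lambda>x. ennreal (exponential_density 1 x))"
    and S [measurable]: "S \<in> borel_measurable M"
    and char: "\<And>t. char (distr M borel S) t
               = exp (- (complex_of_real (\<bar>t\<bar> powr \<alpha>))
                      * exp (- \<i> * complex_of_real (pi * \<alpha> * sgn t / 2)))"
    and G1: "distributed M lborel G1 (\<lambda>x. ennreal (gamma_density r x))"
    and G2: "distributed M lborel G2 (\<lambda>x. ennreal (gamma_density (1 - r) x))"
  shows "distr M lborel (\<lambda>\<omega>. c * W \<omega> / (S \<omega> * ((G1 \<omega> + G2 \<omega>) / G1 \<omega>) powr (1 / \<alpha>)))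
            = density lborel (\<lambda>x. ennreal (gg_density r \<alpha> (c powr (- \<alpha>)) x))" (is "?A = ?D")
proof -
  interpret prob_space M by fact
  have W_m [measurable]: "W \<in> borel_measurable M" and G1_m [measurable]: "G1 \<in> borel_measurable M"
    and G2_m [measurable]: "G2 \<in> borel_measurable M"
    using W G1 G2 by (auto simp: distributed_def)
  have borel_lborel: "distr M borel V = distr M lborel V" for V :: "'b \<Rightarrow> real"
    by (rule distr_cong) auto
  have DW: "distr M borel W = density lborel (\<lambda>x. ennreal (exponential_density 1 x))"
    and DG1: "distr M borel G1 = density lborel (\<lambda>x. ennreal (gamma_density r x))"
    and DG2: "distr M borel G2 = density lborel (\<lambda>x. ennreal (gamma_density (1 - r) x))"
    using W G1 G2 unfolding borel_lborel by (auto simp: distributed_def)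
  interpret S: real_distribution "distr M borel S" by (rule real_distribution_distr) simp
  let ?Y = "\<lambda>w s g g'. c * w / (s * ((g + g') / g) powr (1 / \<alpha>))"
  have tail: "emeasure ?A {x<..} = emeasure ?D {x<..}" if x: "0 \<le> x" for x
  proof -
    \<comment> \<open>The threshold \<open>x\<close> on the gamma scale: for \<open>z > 0\<close>,
      \<open>c powr (- \<alpha>) * z powr \<alpha>\<close> exceeds \<open>y\<close> exactly when
      \<open>z\<close> exceeds \<open>x\<close>.\<close>
    define y where "y = (x / c) powr \<alpha>"
    have y: "0 \<le> y" by (simp add: y_def)
    let ?h = "\<lambda>w s g g'. indicator {x<..} (?Y w s g g') :: ennreal"
    have Wint: "(\<integral>\<^sup>+w. ?h w s g g' \<partial>distr M borel W) = ennreal (exp (- (x * ((g + g') / g) powr (1 / \<alpha>) / c) * s))"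
      if s: "s > 0" and g: "g > 0" "g' > 0" for s g g'
    proof -
      let ?z = "((g + g') / g) powr (1 / \<alpha>)"
      have z: "?z > 0" using g by simp
      let ?a = "x * ?z / c * s"
      have "(\<integral>\<^sup>+w. ?h w s g g' \<partial>distr M borel W) = (\<integral>\<^sup>+w. indicator {?a<..} w \<partial>distr M borel W)"
        using s z c by (intro nn_integral_cong) (auto simp: indicator_def field_simps)
      also have "\<dots> = emeasure M (W -` {?a<..} \<inter> space M)"
        by (simp add: emeasure_distr)
      also have "W -` {?a<..} \<inter> space M = {\<omega> \<in> space M. ?a < W \<omega>}" by auto
      also have "emeasure M \<dots> = ennreal (exp (- ?a * 1))"
        unfolding emeasure_eq_measure using x c s z
        by (subst exponential_distributedD_gt[OF W]) auto
      finally show ?thesis by simp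
    qed
    have Sint: "(\<integral>\<^sup>+s. \<integral>\<^sup>+w. ?h w s g g' \<partial>distr M borel W \<partial>distr M borel S) = ennreal (exp (- y)) * ennreal (exp (- (y / g) * g'))"
      if g: "g > 0" "g' > 0" for g g'
    proof -
      let ?b = "x * ((g + g') / g) powr (1 / \<alpha>) / c"
      have "(\<integral>\<^sup>+s. \<integral>\<^sup>+w. ?h w s g g' \<partial>distr M borel W \<partial>distr M borel S) = (\<integral>\<^sup>+s. ennreal (exp (- ?b * s)) \<partial>distr M borel S)"
        using S.stable_char_Laplace(1)[OF \<alpha> char] Wint[OF _ g] by (intro nn_integral_cong_AE) auto
      also have "\<dots> = ennreal (exp (- (?b powr \<alpha>)))"
        using x c by (intro S.stable_char_Laplace(2)[OF \<alpha> char]) auto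
      \<comment> \<open>The exponent \<open>\<alpha>\<close> of the stable Laplace transform undoes
        the \<open>1 / \<alpha>\<close>, so the result is affine in \<open>g'\<close> and ready for
        the Laplace transform of \<open>G2\<close>.\<close>
      also have "?b powr \<alpha> = y * ((g + g') / g)"
      proof -
        have "?b powr \<alpha> = ((x / c) * ((g + g') / g) powr (1 / \<alpha>)) powr \<alpha>" by simp
        also have "\<dots> = y * ((g + g') / g)"
          unfolding y_def using x c g \<alpha> by (subst powr_mult) (auto simp: powr_powr)
        finally show ?thesis .
      qed
      also have "exp (- (y * ((g + g') / g))) = exp (- y) * exp (- (y / g) * g')"
        using g by (simp add: field_simps flip: exp_add)
      finally show ?thesis by (simp add: ennreal_mult')
    qed
    have G2int: "(\<integral>\<^sup>+g'. \<integral>\<^sup>+s. \<integral>\<^sup>+w. ?h w s g g' \<partial>distr M borel W \<partial>distr M borel S \<partial>distr M borel G2) =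
      ennreal (exp (- y) * (1 + y / g) powr (- (1 - r)))" if g: "g > 0" for g
    proof -
      have "(\<integral>\<^sup>+g'. \<integral>\<^sup>+s. \<integral>\<^sup>+w. ?h w s g g' \<partial>distr M borel W \<partial>distr M borel S \<partial>distr M borel G2) =
        (\<integral>\<^sup>+g'. ennreal (exp (- y)) * ennreal (exp (- (y / g) * g')) \<partial>distr M borel G2)"
      proof (rule nn_integral_cong_AE)
        have "AE g' in distr M borel G2. 0 < g'"
          unfolding DG2 by (subst AE_density) (auto simp: gamma_density_def)
        then show "AE g' in distr M borel G2. (\<integral>\<^sup>+s. \<integral>\<^sup>+w. ?h w s g g' \<partial>distr M borel W \<partial>distr M borel S) = ennreal (exp (- y)) * ennreal (exp (- (y / g) * g'))"
          by eventually_elim (rule Sint[OF g])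
      qed
      also have "\<dots> = ennreal (exp (- y)) * (\<integral>\<^sup>+g'. ennreal (exp (- (y / g) * g')) \<partial>distr M borel G2)"
        by (intro nn_integral_cmult) auto
      also have "(\<integral>\<^sup>+g'. ennreal (exp (- (y / g) * g')) \<partial>distr M borel G2) = ennreal ((1 + y / g) powr (- (1 - r)))"
        unfolding DG2 using gamma_density_Laplace[of "1 - r" "y / g"] r y g by (subst nn_integral_density) auto
      finally show ?thesis by (simp add: ennreal_mult')
    qed
    have "emeasure ?A {x<..} = (\<integral>\<^sup>+\<omega>. ?h (W \<omega>) (S \<omega>) (G1 \<omega>) (G2 \<omega>) \<partial>M)"
      by (subst nn_integral_indicator[symmetric], simp, subst nn_integral_distr) auto
    also have "\<dots> = (\<integral>\<^sup>+g. \<integral>\<^sup>+g'. \<integral>\<^sup>+s. \<integral>\<^sup>+w. ?h w s g g' \<partial>distr M borel W \<partial>distr M borel S \<partial>distr M borel G2 \<partial>distr M borel G1)"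
      using nn_integral_indep_vars_4[OF indep, of ?h] by simp
    also have "\<dots> = (\<integral>\<^sup>+g. ennreal (exp (- y) * (1 + y / g) powr (- (1 - r))) \<partial>distr M borel G1)"
    proof (rule nn_integral_cong_AE)
      have "AE g in distr M borel G1. 0 < g"
        unfolding DG1 by (subst AE_density) (auto simp: gamma_density_def)
      then show "AE g in distr M borel G1. (\<integral>\<^sup>+g'. \<integral>\<^sup>+s. \<integral>\<^sup>+w. ?h w s g g' \<partial>distr M borel W \<partial>distr M borel S \<partial>distr M borel G2) =
      ennreal (exp (- y) * (1 + y / g) powr (- (1 - r)))"
        by eventually_elim (rule G2int)
    qed
    also have "\<dots> = (\<integral>\<^sup>+g. ennreal (gamma_density r g) * ennreal (exp (- y) * (1 + y / g) powr (- (1 - r))) \<partial>lborel)"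
      unfolding DG1 by (subst nn_integral_density) auto
    also have "\<dots> = (\<integral>\<^sup>+u. ennreal (gamma_density r u) * indicator {y<..} u \<partial>lborel)"
      by (rule gamma_density_tail_mixture[OF r(1) y])
    also have "\<dots> = (\<integral>\<^sup>+z. ennreal (gg_density r \<alpha> (c powr (- \<alpha>)) z) * indicator {y<..} (c powr (- \<alpha>) * z powr \<alpha>) \<partial>lborel)"
      using r \<alpha> c by (intro nn_integral_gg_density_powr[symmetric]) auto
    also have "\<dots> = (\<integral>\<^sup>+z. ennreal (gg_density r \<alpha> (c powr (- \<alpha>)) z) * indicator {x<..} z \<partial>lborel)"
    proof (rule nn_integral_cong)
      fix z
      show "ennreal (gg_density r \<alpha> (c powr (- \<alpha>)) z) * indicator {y<..} (c powr (- \<alpha>) * z powr \<alpha>) =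
        ennreal (gg_density r \<alpha> (c powr (- \<alpha>)) z) * indicator {x<..} z"
      proof (cases "z > 0")
        case True
        have "c powr (- \<alpha>) * z powr \<alpha> = (z / c) powr \<alpha>"
          using True c by (simp add: powr_divide powr_minus_divide)
        moreover have "(x / c) powr \<alpha> < (z / c) powr \<alpha> \<longleftrightarrow> x / c < z / c"
          using True c x \<alpha> by (metis divide_nonneg_pos less_imp_le not_less powr_less_mono2 powr_mono2)
        ultimately show ?thesis using c by (simp add: y_def indicator_def divide_less_cancel)
      qed (simp add: gg_density_def)
    qed
    also have "\<dots> = emeasure ?D {x<..}" by (simp add: emeasure_density)
    finally show ?thesis .
  qed
  interpret A: real_distribution ?A
  proof -
    interpret A: prob_space ?A by (rule prob_space_distr) simp
    show "real_distribution ?A" by standard auto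
  qed
  interpret D: real_distribution ?D using real_distribution_gg r \<alpha> c by simp
  have cdf_pos: "cdf ?A x = cdf ?D x" if "0 \<le> x" for x
  proof -
    have "measure ?A {x<..} = measure ?D {x<..}" using tail[OF that] by (simp add: measure_def)
    moreover have "UNIV - {x<..} = {..x}" by auto
    ultimately show ?thesis
      using A.prob_compl[of "{x<..}"] D.prob_compl[of "{x<..}"] by (simp add: cdf_def)
  qed
  \<comment> \<open>The tails agree only for \<open>x \<ge> 0\<close>. As \<open>?D\<close> has no
    mass on the nonpositive half line, equality at 0 and monotonicity make both distribution
    functions vanish below 0.\<close>
  have "emeasure ?D {..0} = 0"
  proof -
    have "emeasure ?D {..0} = (\<integral>\<^sup>+x. 0 \<partial>(lborel :: real measure))"
      by (subst emeasure_density, simp, simp, intro nn_integral_cong) (auto simp: gg_density_def indicator_def)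
    then show ?thesis by simp
  qed
  then have D0: "cdf ?D 0 = 0" by (simp add: cdf_def measure_def)
  have "cdf ?A x = cdf ?D x" for x
  proof (cases "0 \<le> x")
    case False
    then have "cdf ?A x \<le> cdf ?A 0" "cdf ?D x \<le> cdf ?D 0"
      by (auto intro!: A.cdf_nondecreasing D.cdf_nondecreasing)
    moreover have "cdf ?A 0 = 0" using cdf_pos[of 0] D0 by simp
    ultimately show ?thesis using D0 A.cdf_nonneg[of x] D.cdf_nonneg[of x] by linarith
  qed (rule cdf_pos)
  then show ?thesis
    by (intro cdf_unique A.real_distribution_axioms D.real_distribution_axioms ext)
qed

theorem theorem5:
  fixes M :: "'a measure"
    and X :: "nat \<Rightarrow> 'a \<Rightarrow> real"
    and N :: "nat \<Rightarrow> 'a \<Rightarrow> nat"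
    and c r \<alpha> :: real
  assumes "prob_space M"
    and iid_indep: "prob_space.indep_vars M (\<lambda>_. borel) X UNIV"
    and iid_distr: "\<And>i. distr M borel (X i) = distr M borel (X 0)"
    and nonneg: "\<And>j \<omega>. \<omega> \<in> space M \<Longrightarrow> X j \<omega> \<ge> 0"
    and c_pos: "0 < c"
    and slln: "AE \<omega> in M. (\<lambda>n. (\<Sum>j<n. X j \<omega>) / real n) \<longlonglongrightarrow> c"
    and r_pos: "0 < r"
    and \<alpha>_nz: "\<alpha> \<noteq> 0"
    and N_rv: "\<And>n. N n \<in> measurable M (count_space UNIV)"
    and N_distr: "\<And>n k. n \<ge> 1 \<Longrightarrow>
        measure M {\<omega> \<in> space M. N n \<omega> = k} = gnb_pmf r \<alpha> (real n powr (- \<alpha>)) k"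
    and N_indep: "\<And>n. n \<ge> 1 \<Longrightarrow>
        prob_space.indep_set M
          (sigma_sets (space M) {N n -` A \<inter> space M | A. A \<in> sets (count_space UNIV)})
          (sigma_sets (space M) (\<Union>i. {X i -` A \<inter> space M | A. A \<in> sets borel}))"
  shows "((\<lambda>n. SUP x\<in>{0..}. \<bar>measure M {\<omega> \<in> space M. (\<Sum>j<N n \<omega>. X j \<omega>) < real n * x}
              - (LBINT z=0..x. gg_density r \<alpha> (c powr (- \<alpha>)) z)\<bar>) \<longlonglongrightarrow> 0)
    \<and> (r < 1 \<and> 0 < \<alpha> \<and> \<alpha> < 1 \<longrightarrow>
      (\<forall>M' :: 'b measure. \<forall>W S G1 G2.
        prob_space M'
        \<and> prob_space.indep_vars M' (\<lambda>_. borel)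
            (\<lambda>i::nat. if i = 0 then W else if i = 1 then S else if i = 2 then G1 else G2) {0, 1, 2, 3}
        \<and> distributed M' lborel W (\<lambda>x. ennreal (exponential_density 1 x))
        \<and> S \<in> borel_measurable M'
        \<and> (\<forall>t. char (distr M' borel S) t
               = exp (- (complex_of_real (\<bar>t\<bar> powr \<alpha>))
                      * exp (- \<i> * complex_of_real (pi * \<alpha> * sgn t / 2))))
        \<and> distributed M' lborel G1 (\<lambda>x. ennreal (gamma_density r x))
        \<and> distributed M' lborel G2 (\<lambda>x. ennreal (gamma_density (1 - r) x))
        \<longrightarrow> distr M' lborel
              (\<lambda>\<omega>. c * W \<omega> / (S \<omega> * ((G1 \<omega> + G2 \<omega>) / G1 \<omega>) powr (1 / \<alpha>)))
            = density lborel (\<lambda>x. ennreal (gg_density r \<alpha> (c powr (- \<alpha>)) x))))"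
proof (intro conjI impI allI)
  interpret prob_space M by fact
  have X: "X i \<in> borel_measurable M" for i
    using iid_indep by (simp add: indep_vars_def)
  show "(\<lambda>n. SUP x\<in>{0..}. \<bar>measure M {\<omega> \<in> space M. (\<Sum>j<N n \<omega>. X j \<omega>) < real n * x}
              - (LBINT z=0..x. gg_density r \<alpha> (c powr (- \<alpha>)) z)\<bar>) \<longlonglongrightarrow> 0"
    by (rule gnb_random_sum_uniform[OF X nonneg c_pos slln r_pos \<alpha>_nz N_rv N_distr N_indep])
qed (use c_pos r_pos in \<open>blast intro: gg_mixed_exponential\<close>)

end
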